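(* There is a universal constant $C>0$ such that in any weighted graph on $n$ vertices there exists a ternary signaling scheme that is persuasive and has cost at most $C\, n^{3/4}\cdot(\mathsf{OPT}^{\mathsf{IR}})^{1/2}$. In addition, for any $\delta\in(0,1]$ and any weighted graph on $n$ vertices all of whose edge weights are at least $\delta$, there is a persuasive ternary signaling scheme with cost at most $C\,(n\cdot\mathsf{OPT}^{\mathsf{IR}})^{2/3}\delta^{-1/3}$. Finally, the resulting $O(n^{2/3})$ approximation ratio is tight on a family of graphs with $\delta=1/2$: there is a universal constant $c>0$ and a family of weighted graphs with arbitrarily large $n$, all of whose edge weights equal $1/2$, on which $\mathsf{OPT}^{\mathsf{IR}}=O(1)$ and every persuasive signaling scheme (with any finite signal space) has cost at least $c\,n^{2/3}$.
   Context: Setting. $V$ is a finite set of $n$ task types and $W=(W_{u,v})_{u,v\in V}$ is a symmetric matrix with entries in $[0,1]$ and $W_{v,v}=1$ for all $v$. It is represented by the weighted graph $G=(V,E,w)$ with $E=\{\{u,v\}:u\neq v,\ W_{u,v}>0\}$ and edge weights $w(\{u,v\})=W_{u,v}$ ("edge weights at least $\delta$" means $W_{u,v}\ge\delta$ for every edge). A vector $\theta\in\mathbb{R}_{\ge0}^V$ is feasible if $W\theta\ge\mathbf 1$ coordinatewise. $\mathsf{OPT}^{\mathsf{IR}}=\min\{\|\theta\|_1:\theta\in[0,1]^V\text{ feasible}\}$. Signaling. There are $n$ agents; the type profile $t=(t_1,\dots,t_n)$ is a uniformly random bijection $[n]\to V$. A signaling scheme with finite signal space $\Sigma\subset[0,1]$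 is a map $\varphi$ assigning to each bijection $t$ a distribution $\varphi(t)$ on $\Sigma^V$; given $t$, $s=(s_v)_{v\in V}\sim\varphi(t)$ is drawn and agent $i$ privately receives $s_{t_i}$. For agent $i$, a signal $\theta\in\Sigma$ with $\Pr[s_{t_i}=\theta]>0$ and $x\ge0$, let $Q_i(x\mid\theta)=\mathbb{E}\big[x+\sum_{v'\neq t_i}W_{t_i,v'}s_{v'}\,\big|\,s_{t_i}=\theta\big]$ (over the joint law of $t,s$). The scheme is persuasive if for every agent $i$ and every such $\theta$: $Q_i(\theta\mid\theta)\ge1$ and $\theta=\min\{x\ge0:Q_i(x\mid\theta)\ge1\}$. Its cost is $\mathbb{E}[\|s\|_1]$. A ternary signaling scheme is one with $|\Sigma|=3$. *)

theory Defs
  imports "HOL-Probability.Probability" "HOL-Combinatorics.Permutations"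
begin

text \<open>Vertices (task types) and agents are both identified with {..<n}.
  W :: nat => nat => real is only relevant on {..<n} x {..<n}.\<close>

definition weighted_graph :: "nat \<Rightarrow> (nat \<Rightarrow> nat \<Rightarrow> real) \<Rightarrow> bool" where
  "weighted_graph n W \<longleftrightarrow>
     (\<forall>u<n. \<forall>v<n. W u v = W v u \<and> 0 \<le> W u v \<and> W u v \<le> 1) \<and> (\<forall>v<n. W v v = 1)"

definition edge_weights_ge :: "nat \<Rightarrow> (nat \<Rightarrow> nat \<Rightarrow> real) \<Rightarrow> real \<Rightarrow> bool" where
  "edge_weights_ge n W \<delta> \<longleftrightarrow> (\<forall>u<n. \<forall>v<n. u \<noteq> v \<and> W u v > 0 \<longrightarrow> W u v \<ge> \<delta>)"

definition edge_weights_eq :: "nat \<Rightarrow> (nat \<Rightarrow> nat \<Rightarrow> real) \<Rightarrow> real \<Rightarrow> bool" where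
  "edge_weights_eq n W \<delta> \<longleftrightarrow> (\<forall>u<n. \<forall>v<n. u \<noteq> v \<and> W u v > 0 \<longrightarrow> W u v = \<delta>)"

definition feasible :: "nat \<Rightarrow> (nat \<Rightarrow> nat \<Rightarrow> real) \<Rightarrow> (nat \<Rightarrow> real) \<Rightarrow> bool" where
  "feasible n W \<theta> \<longleftrightarrow> (\<forall>v<n. 0 \<le> \<theta> v) \<and> (\<forall>u<n. (\<Sum>v<n. W u v * \<theta> v) \<ge> 1)"

definition OPT_IR :: "nat \<Rightarrow> (nat \<Rightarrow> nat \<Rightarrow> real) \<Rightarrow> real" where
  "OPT_IR n W = Inf {(\<Sum>v<n. \<theta> v) | \<theta>. (\<forall>v<n. \<theta> v \<le> 1) \<and> feasible n W \<theta>}"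

definition profiles :: "nat \<Rightarrow> (nat \<Rightarrow> nat) set" where
  "profiles n = {t. t permutes {..<n}}"

text \<open>A signaling scheme with signal space S: for each profile t a distribution on
  signal vectors s with s v in S for v < n (and s v = 0 for v >= n, a normalisation).\<close>
definition signaling_scheme :: "nat \<Rightarrow> real set \<Rightarrow> ((nat \<Rightarrow> nat) \<Rightarrow> (nat \<Rightarrow> real) pmf) \<Rightarrow> bool" where
  "signaling_scheme n S \<phi> \<longleftrightarrow> finite S \<and> S \<subseteq> {0..1} \<and>
     (\<forall>t\<in>profiles n. \<forall>s\<in>set_pmf (\<phi> t). (\<forall>v<n. s v \<in> S) \<and> (\<forall>v. n \<le> v \<longrightarrow> s v = 0))"

definition joint :: "nat \<Rightarrow> ((nat \<Rightarrow> nat) \<Rightarrow> (nat \<Rightarrow> real) pmf) \<Rightarrow> ((nat \<Rightarrow> nat) \<times> (nat \<Rightarrow> real)) pmf" where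
  "joint n \<phi> = bind_pmf (pmf_of_set (profiles n)) (\<lambda>t. map_pmf (\<lambda>s. (t, s)) (\<phi> t))"

definition recv_event :: "nat \<Rightarrow> real \<Rightarrow> ((nat \<Rightarrow> nat) \<times> (nat \<Rightarrow> real)) set" where
  "recv_event i \<theta> = {(t, s). s (t i) = \<theta>}"

definition Q :: "nat \<Rightarrow> (nat \<Rightarrow> nat \<Rightarrow> real) \<Rightarrow> ((nat \<Rightarrow> nat) \<Rightarrow> (nat \<Rightarrow> real) pmf)
                   \<Rightarrow> nat \<Rightarrow> real \<Rightarrow> real \<Rightarrow> real" where
  "Q n W \<phi> i x \<theta> = measure_pmf.expectation (cond_pmf (joint n \<phi>) (recv_event i \<theta>))
      (\<lambda>(t, s). x + (\<Sum>v'\<in>{..<n} - {t i}. W (t i) v' * s v'))"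

definition persuasive :: "nat \<Rightarrow> (nat \<Rightarrow> nat \<Rightarrow> real) \<Rightarrow> real set
                           \<Rightarrow> ((nat \<Rightarrow> nat) \<Rightarrow> (nat \<Rightarrow> real) pmf) \<Rightarrow> bool" where
  "persuasive n W S \<phi> \<longleftrightarrow>
     (\<forall>i<n. \<forall>\<theta>\<in>S. measure_pmf.prob (joint n \<phi>) (recv_event i \<theta>) > 0 \<longrightarrow>
        Q n W \<phi> i \<theta> \<theta> \<ge> 1 \<and> \<theta> = (LEAST x. x \<ge> 0 \<and> Q n W \<phi> i x \<theta> \<ge> 1))"

definition cost :: "nat \<Rightarrow> ((nat \<Rightarrow> nat) \<Rightarrow> (nat \<Rightarrow> real) pmf) \<Rightarrow> real" where
  "cost n \<phi> = measure_pmf.expectation (joint n \<phi>) (\<lambda>(t, s). \<Sum>v<n. \<bar>s v\<bar>)"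

end

theory Submission
  imports Defs
begin

text \<open>
  Persuasiveness only constrains, for each signal, the expected slack \<open>(W s)\<^sub>v - 1\<close> summed over the
  recipients of that signal: it must vanish for positive signals and be nonnegative for signal 0.

  Upper bounds: round a near-optimal individually rational solution independently and give it a
  signal \<open>a\<close> slightly below 1. Its members over-serve each other, and its neighbours receive slightly
  less than 1. The over-service is compensated by occasionally giving \<open>a\<close> to a sparse random set of
  other vertices, which see almost nothing; the deficit at signal 0 is compensated by
  occasionally giving 0 to the core and a small signal \<open>b\<close> to everybody else, which over-serves the
  core massively. If the graph is too dense for this to work, a constant signal is cheap.

  Lower bound: take \<open>L\<^sup>2\<close> cliques of size \<open>L\<close> plus two vertices adjacent to everything, with all
  weights 1/2. Pricing the slack of a recipient of \<open>\<theta>\<close> by a suitable function of \<open>\<theta>\<close> bounds the priced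
  total slack of every signal vector by a constant times its cost minus a multiple of \<open>L\<^sup>2\<close>.
\<close>

section \<open>Persuasiveness in terms of slack\<close>

text \<open>Let \<open>k\<close> be the expected core size and \<open>D\<close> the average weighted
  degree among the other vertices, about \<open>n\<close> many. The core over-serves itself by up to
  \<open>k^2\<close> in expectation, and tightness fixes \<open>a\<close> as a ratio of
  expectations; with the core alone, \<open>1 - a\<close> need not be small, and all
  \<open>n\<close> neighbours lose that much. An expected \<open>q * f * n\<close> further
  recipients of \<open>a\<close> dilute the average: the total loss drops to about
  \<open>k^2 / (q * f)\<close>, plus \<open>f * D * n\<close> for the weight inside the sparse set.
  For a target cost \<open>X\<close>, sending \<open>b\<close>, about \<open>1 / D\<close>, with
  probability \<open>X * D / (2 * n)\<close> costs O(\<open>X\<close>) and buys slack of order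
  \<open>X\<close>, so every loss must be a small fraction of \<open>X\<close>. The exponents come
  from isolating the sparse set. For general weights all other vertices are given 0, so
  \<open>q\<close> is about \<open>X / n\<close> and \<open>f\<close> about
  \<open>X / (n * D)\<close>; as \<open>D\<close> is at most \<open>n / X\<close> (else the graph is
  dense), \<open>X^4\<close> of order \<open>k^2 * n^3\<close> suffices. For weights at least
  \<delta>, only about \<open>f * D * n / \<delta>\<close> neighbours are given 0; then
  \<open>q\<close> may be \<open>X * D / (2 * n)\<close> with \<open>f\<close> about
  \<open>X * \<delta> / (n * D)\<close>, and \<open>X^3 * \<delta>\<close> of order
  \<open>k^2 * n^2\<close> suffices.\<close>

definition slack :: "nat \<Rightarrow> (nat \<Rightarrow> nat \<Rightarrow> real) \<Rightarrow> (nat \<Rightarrow> real) \<Rightarrow> nat \<Rightarrow> real" where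
  "slack n W s v = (\<Sum>u<n. W v u * s u) - 1"

lemma expectation_cond_pmf:
  fixes f :: "'a \<Rightarrow> real"
  assumes "finite (set_pmf P)" "measure_pmf.prob P A > 0"
  shows "measure_pmf.expectation (cond_pmf P A) f =
         measure_pmf.expectation P (\<lambda>x. indicator A x * f x) / measure_pmf.prob P A"
proof -
  have ne: "set_pmf P \<inter> A \<noteq> {}"
    using assms(2) by (metis Int_commute disjoint_iff measure_pmf_zero_iff less_irrefl)
  have "measure_pmf.expectation (cond_pmf P A) f
      = (\<Sum>x\<in>set_pmf P. pmf (cond_pmf P A) x *\<^sub>R f x)"
    using assms(1) set_cond_pmf[OF ne] by (intro integral_measure_pmf) auto
  also have "\<dots> = (\<Sum>x\<in>set_pmf P. pmf P x *\<^sub>R (indicator A x * f x)) / measure_pmf.prob P A"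
    unfolding sum_divide_distrib by (intro sum.cong) (auto simp: pmf_cond[OF ne] indicator_def)
  also have "(\<Sum>x\<in>set_pmf P. pmf P x *\<^sub>R (indicator A x * f x))
      = measure_pmf.expectation P (\<lambda>x. indicator A x * f x)"
    using assms(1) by (intro integral_measure_pmf[symmetric]) auto
  finally show ?thesis .
qed

lemma finite_profiles [simp]: "finite (profiles n)"
  and profiles_nonempty [simp]: "profiles n \<noteq> {}"
proof -
  show "finite (profiles n)" by (simp add: profiles_def finite_permutations)
  show "profiles n \<noteq> {}" using permutes_id[of "{..<n}"] unfolding profiles_def by blast
qed

lemma profiles_lessI: "t \<in> profiles n \<Longrightarrow> i < n \<Longrightarrow> t i < n"
  unfolding profiles_def using permutes_in_image by fastforce

lemma set_pmf_joint:
  "set_pmf (joint n \<phi>) = (\<Union>t\<in>profiles n. Pair t ` set_pmf (\<phi> t))"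
  by (auto simp: joint_def set_pmf_of_set)

lemma finite_signal_vectors:
  assumes "finite S"
  shows "finite {s :: nat \<Rightarrow> real. (\<forall>v<n. s v \<in> S) \<and> (\<forall>v. n \<le> v \<longrightarrow> s v = 0)}"
proof -
  have "{s :: nat \<Rightarrow> real. (\<forall>v<n. s v \<in> S) \<and> (\<forall>v. n \<le> v \<longrightarrow> s v = 0)}
     \<subseteq> {s. \<forall>v. (v \<in> {..<n} \<longrightarrow> s v \<in> S) \<and> (v \<notin> {..<n} \<longrightarrow> s v = 0)}"
    by auto
  moreover have "finite \<dots>"
    by (rule finite_set_of_finite_funs) (use assms in auto)
  ultimately show ?thesis by (rule finite_subset)
qed

lemma finite_set_pmf_joint:
  assumes "signaling_scheme n S \<phi>"
  shows "finite (set_pmf (joint n \<phi>))"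
proof -
  have "finite S" using assms by (simp add: signaling_scheme_def)
  then have "finite (set_pmf (\<phi> t))" if "t \<in> profiles n" for t
    using assms that by (intro finite_subset[OF _ finite_signal_vectors[of S n]])
      (auto simp: signaling_scheme_def)
  then show ?thesis by (auto simp: set_pmf_joint)
qed

text \<open>The conditional mean slack without its normalisation: it is linear in the joint law and
  is simply 0 for signals that are never sent.\<close>

definition slack_moment ::
  "nat \<Rightarrow> (nat \<Rightarrow> nat \<Rightarrow> real) \<Rightarrow> ((nat \<Rightarrow> nat) \<Rightarrow> (nat \<Rightarrow> real) pmf) \<Rightarrow> nat \<Rightarrow> real \<Rightarrow> real" where
  "slack_moment n W \<phi> i \<theta> =
     measure_pmf.expectation (joint n \<phi>) (\<lambda>(t, s). of_bool (s (t i) = \<theta>) * slack n W s (t i))"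

text \<open>As \<open>W v v = 1\<close>, the recipient's own signal enters \<open>W s\<close> as
  \<theta>; replacing it by \<open>x\<close> only shifts the conditional mean by
  \<open>x - \<theta>\<close>.\<close>

lemma Q_eq_slack_moment:
  assumes W: "weighted_graph n W" and sch: "signaling_scheme n S \<phi>" and i: "i < n"
    and pos: "measure_pmf.prob (joint n \<phi>) (recv_event i \<theta>) > 0"
  shows "Q n W \<phi> i x \<theta> =
    x - \<theta> + 1 + slack_moment n W \<phi> i \<theta> / measure_pmf.prob (joint n \<phi>) (recv_event i \<theta>)"
proof -
  let ?J = "joint n \<phi>" and ?A = "recv_event i \<theta>"
  have fin: "finite (set_pmf ?J)" using sch by (rule finite_set_pmf_joint)
  note [simp] = integrable_measure_pmf_finite[OF fin]
  have "measure_pmf.expectation ?J (\<lambda>y. indicator ?A y *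
           (case y of (t, s) \<Rightarrow> x + (\<Sum>v'\<in>{..<n} - {t i}. W (t i) v' * s v')))
      = measure_pmf.expectation ?J (\<lambda>y. (x - \<theta> + 1) * indicator ?A y +
           (case y of (t, s) \<Rightarrow> of_bool (s (t i) = \<theta>) * slack n W s (t i)))"
  proof (intro integral_cong_AE)
    show "AE y in measure_pmf ?J. indicator ?A y *
           (case y of (t, s) \<Rightarrow> x + (\<Sum>v'\<in>{..<n} - {t i}. W (t i) v' * s v'))
        = (x - \<theta> + 1) * indicator ?A y +
           (case y of (t, s) \<Rightarrow> of_bool (s (t i) = \<theta>) * slack n W s (t i))"
    proof (unfold AE_measure_pmf_iff, safe)
      fix t s assume "(t, s) \<in> set_pmf ?J"
      then have ti: "t i < n" using i by (auto simp: set_pmf_joint profiles_lessI)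
      then have "(\<Sum>u<n. W (t i) u * s u)
          = W (t i) (t i) * s (t i) + (\<Sum>v'\<in>{..<n} - {t i}. W (t i) v' * s v')"
        by (subst sum.remove[of _ "t i"]) auto
      moreover have "W (t i) (t i) = 1" using W ti by (auto simp: weighted_graph_def)
      ultimately show "indicator ?A (t, s) *
           (x + (\<Sum>v'\<in>{..<n} - {t i}. W (t i) v' * s v'))
        = (x - \<theta> + 1) * indicator ?A (t, s) + of_bool (s (t i) = \<theta>) * slack n W s (t i)"
        by (auto simp: recv_event_def indicator_def slack_def)
    qed
  qed auto
  also have "\<dots> = (x - \<theta> + 1) * measure_pmf.prob ?J ?A + slack_moment n W \<phi> i \<theta>"
    by (simp add: slack_moment_def)
  finally show ?thesis
    using pos by (simp add: Q_def expectation_cond_pmf[OF fin pos] field_simps)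
qed

text \<open>\<open>Q\<close> has slope 1 in \<open>x\<close>, so the least admissible
  \<open>x\<close> is \<open>max 0 (\<theta> - m)\<close> with \<open>m\<close> the conditional mean
  slack. This equals \<theta> exactly if \<open>m = 0\<close>, or if \<open>\<theta> = 0\<close> and
  \<open>m \<ge> 0\<close>.\<close>

lemma persuasive_iff_slack_moment:
  assumes W: "weighted_graph n W" and sch: "signaling_scheme n S \<phi>"
  shows "persuasive n W S \<phi> \<longleftrightarrow>
    (\<forall>i<n. \<forall>\<theta>\<in>S. (\<theta> = 0 \<longrightarrow> slack_moment n W \<phi> i \<theta> \<ge> 0) \<and> (\<theta> \<noteq> 0 \<longrightarrow> slack_moment n W \<phi> i \<theta> = 0))"
proof -
  have "(measure_pmf.prob (joint n \<phi>) (recv_event i \<theta>) > 0 \<longrightarrow>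
          Q n W \<phi> i \<theta> \<theta> \<ge> 1 \<and> \<theta> = (LEAST x. x \<ge> 0 \<and> Q n W \<phi> i x \<theta> \<ge> 1)) \<longleftrightarrow>
        (\<theta> = 0 \<longrightarrow> slack_moment n W \<phi> i \<theta> \<ge> 0) \<and> (\<theta> \<noteq> 0 \<longrightarrow> slack_moment n W \<phi> i \<theta> = 0)"
    if i: "i < n" and \<theta>: "\<theta> \<in> S" for i \<theta>
  proof (cases "measure_pmf.prob (joint n \<phi>) (recv_event i \<theta>) > 0")
    case True
    define m where "m = slack_moment n W \<phi> i \<theta> / measure_pmf.prob (joint n \<phi>) (recv_event i \<theta>)"
    have q: "Q n W \<phi> i x \<theta> = x - \<theta> + 1 + m" for x
      unfolding m_def by (rule Q_eq_slack_moment[OF W sch i True])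
    have "\<theta> \<ge> 0" using sch \<theta> by (auto simp: signaling_scheme_def)
    have "(LEAST x. x \<ge> 0 \<and> Q n W \<phi> i x \<theta> \<ge> 1) = max 0 (\<theta> - m)"
      by (rule Least_equality) (auto simp: q)
    then have "Q n W \<phi> i \<theta> \<theta> \<ge> 1 \<and> \<theta> = (LEAST x. x \<ge> 0 \<and> Q n W \<phi> i x \<theta> \<ge> 1) \<longleftrightarrow>
        (\<theta> = 0 \<longrightarrow> m \<ge> 0) \<and> (\<theta> \<noteq> 0 \<longrightarrow> m = 0)"
      using \<open>\<theta> \<ge> 0\<close> by (auto simp: q max_def)
    moreover have "m \<ge> 0 \<longleftrightarrow> slack_moment n W \<phi> i \<theta> \<ge> 0" "m = 0 \<longleftrightarrow> slack_moment n W \<phi> i \<theta> = 0"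
      unfolding m_def using True by (auto simp: zero_le_divide_iff)
    ultimately show ?thesis using True by simp
  next
    case False
    then have "measure_pmf.prob (joint n \<phi>) (recv_event i \<theta>) = 0"
      by (simp add: zero_less_measure_iff)
    then have "set_pmf (joint n \<phi>) \<inter> recv_event i \<theta> = {}"
      by (simp add: measure_pmf_zero_iff)
    then have "slack_moment n W \<phi> i \<theta> = measure_pmf.expectation (joint n \<phi>) (\<lambda>_. 0)"
      unfolding slack_moment_def
      by (intro integral_cong_AE) (auto simp: AE_measure_pmf_iff recv_event_def)
    then have "slack_moment n W \<phi> i \<theta> = 0" by simp
    then show ?thesis using False by auto
  qed
  then show ?thesis unfolding persuasive_def by blast
qed

text \<open>The constraints at positive signals are equations, so their multipliers may have any
  sign; only \<open>g 0\<close> must be nonnegative. Since every profile is a bijection, summing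
  over agents amounts to summing over vertices, however the scheme depends on the profile.\<close>

lemma persuasive_weighted_slack:
  assumes W: "weighted_graph n W" and sch: "signaling_scheme n S \<phi>"
    and per: "persuasive n W S \<phi>" and g: "g 0 \<ge> (0::real)"
  shows "measure_pmf.expectation (joint n \<phi>) (\<lambda>(t, s). \<Sum>v<n. g (s v) * slack n W s v) \<ge> 0"
proof -
  let ?J = "joint n \<phi>"
  have fin: "finite (set_pmf ?J)" using sch by (rule finite_set_pmf_joint)
  note int [simp] = integrable_measure_pmf_finite[OF fin]
  have finS: "finite S" using sch by (simp add: signaling_scheme_def)
  have "0 \<le> (\<Sum>i<n. \<Sum>\<theta>\<in>S. g \<theta> * slack_moment n W \<phi> i \<theta>)"
  proof (intro sum_nonneg)
    fix i \<theta> assume "i \<in> {..<n}" "\<theta> \<in> S"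
    with per show "0 \<le> g \<theta> * slack_moment n W \<phi> i \<theta>"
      using g by (cases "\<theta> = 0") (auto simp: persuasive_iff_slack_moment[OF W sch])
  qed
  also have "\<dots> = measure_pmf.expectation ?J (\<lambda>y. \<Sum>i<n. \<Sum>\<theta>\<in>S. g \<theta> *
      (case y of (t, s) \<Rightarrow> of_bool (s (t i) = \<theta>) * slack n W s (t i)))"
    by (simp add: slack_moment_def)
  also have "\<dots> = measure_pmf.expectation ?J (\<lambda>(t, s). \<Sum>v<n. g (s v) * slack n W s v)"
  proof (intro integral_cong_AE)
    show "AE y in measure_pmf ?J. (\<Sum>i<n. \<Sum>\<theta>\<in>S. g \<theta> *
        (case y of (t, s) \<Rightarrow> of_bool (s (t i) = \<theta>) * slack n W s (t i)))
      = (case y of (t, s) \<Rightarrow> \<Sum>v<n. g (s v) * slack n W s v)"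
    proof (unfold AE_measure_pmf_iff, safe)
      fix t s assume ts: "(t, s) \<in> set_pmf ?J"
      then have t: "t permutes {..<n}" by (auto simp: set_pmf_joint profiles_def)
      have "(\<Sum>\<theta>\<in>S. g \<theta> * (of_bool (s (t i) = \<theta>) * slack n W s (t i)))
          = g (s (t i)) * slack n W s (t i)" if "i < n" for i
      proof -
        have "t i < n" using t that by (simp add: profiles_lessI profiles_def)
        then have "s (t i) \<in> S" using ts sch by (auto simp: set_pmf_joint signaling_scheme_def)
        then show ?thesis using finS
          by (subst sum.remove[of _ "s (t i)"]) (auto intro!: sum.neutral)
      qed
      then have "(\<Sum>i<n. \<Sum>\<theta>\<in>S. g \<theta> * (of_bool (s (t i) = \<theta>) * slack n W s (t i)))
          = (\<Sum>i<n. g (s (t i)) * slack n W s (t i))" by simp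
      also have "\<dots> = (\<Sum>v<n. g (s v) * slack n W s v)"
        using sum.permute[OF t, of "\<lambda>v. g (s v) * slack n W s v"] by (simp add: o_def)
      finally show "(\<Sum>i<n. \<Sum>\<theta>\<in>S. g \<theta> * (of_bool (s (t i) = \<theta>) * slack n W s (t i)))
          = (\<Sum>v<n. g (s v) * slack n W s v)" .
    qed
  qed auto
  finally show ?thesis .
qed

text \<open>Weak linear programming duality: \<open>g\<close> is the dual solution, and
  \<open>bound\<close> is its feasibility. As \<open>bound\<close> ranges over all vectors in the
  unit cube, the conclusion covers every finite signal space.\<close>

lemma cost_lower_bound_dual:
  assumes W: "weighted_graph n W" and sch: "signaling_scheme n S \<phi>"
    and per: "persuasive n W S \<phi>" and g: "g 0 \<ge> (0::real)"
    and bound: "\<And>s. (\<And>v. v < n \<Longrightarrow> 0 \<le> s v \<and> s v \<le> 1) \<Longrightarrow>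
        (\<Sum>v<n. g (s v) * slack n W s v) \<le> lam * (\<Sum>v<n. s v) - mu"
  shows "mu \<le> lam * cost n \<phi>"
proof -
  let ?J = "joint n \<phi>"
  have fin: "finite (set_pmf ?J)" using sch by (rule finite_set_pmf_joint)
  note int [simp] = integrable_measure_pmf_finite[OF fin]
  have "0 \<le> measure_pmf.expectation ?J (\<lambda>(t, s). \<Sum>v<n. g (s v) * slack n W s v)"
    using persuasive_weighted_slack[where g = g, OF W sch per] g by simp
  also have "\<dots> \<le> measure_pmf.expectation ?J (\<lambda>y. lam * (case y of (t, s) \<Rightarrow> \<Sum>v<n. \<bar>s v\<bar>) - mu)"
  proof (intro integral_mono_AE)
    show "AE y in measure_pmf ?J. (case y of (t, s) \<Rightarrow> \<Sum>v<n. g (s v) * slack n W s v)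
        \<le> lam * (case y of (t, s) \<Rightarrow> \<Sum>v<n. \<bar>s v\<bar>) - mu"
    proof (unfold AE_measure_pmf_iff, safe)
      fix t s assume "(t, s) \<in> set_pmf ?J"
      then have "s v \<in> S" if "v < n" for v
        using sch that by (auto simp: set_pmf_joint signaling_scheme_def)
      then have *: "\<And>v. v < n \<Longrightarrow> 0 \<le> s v \<and> s v \<le> 1"
        using sch unfolding signaling_scheme_def by (meson atLeastAtMost_iff subsetD)
      then have "(\<Sum>v<n. \<bar>s v\<bar>) = (\<Sum>v<n. s v)" by (intro sum.cong) auto
      with bound[OF *] show "(\<Sum>v<n. g (s v) * slack n W s v) \<le> lam * (\<Sum>v<n. \<bar>s v\<bar>) - mu" by simp
    qed
  qed auto
  also have "\<dots> = lam * cost n \<phi> - mu" by (simp add: cost_def)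
  finally show ?thesis by simp
qed

section \<open>Lower bound\<close>

text \<open>The cliques are the intervals of constant \<open>v div L\<close> below
  \<open>L ^ 3\<close>. If both core vertices have signal 1, they serve every clique vertex with
  exactly 1, but themselves with 3/2; this tension drives the bound.\<close>

definition clique_graph :: "nat \<Rightarrow> nat \<Rightarrow> nat \<Rightarrow> real" where
  "clique_graph L u v =
     (if u = v then 1 else if L ^ 3 \<le> u \<or> L ^ 3 \<le> v \<or> u div L = v div L then 1/2 else 0)"

text \<open>With the linear part alone, a clique of total signal \<open>S\<close> contributes at most about
  \<open>L * (- (y - r)\<^sup>2 - r * (1 - r))\<close>, where \<open>y = 1 - S / 2\<close> and \<open>r\<close> is the mean signal of the two core
  vertices. This vanishes at \<open>r = 0\<close>, where the cliques themselves are expensive, and at \<open>r = 1\<close>. The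
  jump near 1 penalises the latter, since the two core vertices then over-serve each other.\<close>

definition dual_price :: "nat \<Rightarrow> real \<Rightarrow> real" where
  "dual_price L \<theta> = 1 - L * \<theta> / 2 - (real L)\<^sup>2 / 32 * of_bool (\<theta> \<ge> 1 - 1 / L)"

text \<open>The jump rewards under-served vertices of high signal, and this reward must stay small.
  If \<open>S / 2 + r\<close> is at least \<open>1 / 2 + 1 / (2 * L)\<close>, vertices of high
  signal have nonnegative slack. Otherwise the clique has room for only one of them, with slack at
  least \<open>- 1 / L\<close>, so the reward is at most \<open>L / 32\<close>; the square pays for
  it because \<open>1 - S / 2 - r\<close> is at least 1/4.\<close>

lemma high_signal_slack_bound:
  fixes s :: "nat \<Rightarrow> real" and L :: nat
  assumes fin: "finite C" and s: "\<And>v. v \<in> C \<Longrightarrow> 0 \<le> s v"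
    and L: "L \<ge> 8" and r: "0 \<le> r" and S: "S = (\<Sum>v\<in>C. s v)"
  shows "- ((real L)\<^sup>2 / 32) * (\<Sum>v\<in>C. of_bool (s v \<ge> 1 - 1 / L) * (s v / 2 + S / 2 + r - 1))
     \<le> L / 2 * (1 - S / 2 - r)\<^sup>2"
proof -
  define e where "e = 1 / real L"
  have e: "0 < e" "e \<le> 1 / 8" using L by (auto simp: e_def field_simps)
  let ?sum = "\<Sum>v\<in>C. of_bool (s v \<ge> 1 - e) * (s v / 2 + S / 2 + r - 1)"
  have sS: "s v \<le> S" if "v \<in> C" for v
    unfolding S using fin s that by (intro member_le_sum) auto
  show ?thesis
  proof (cases "S / 2 + r \<ge> 1 / 2 + e / 2")
    case True
    then have "?sum \<ge> 0" by (intro sum_nonneg) (auto simp: field_simps)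
    then have "- ((real L)\<^sup>2 / 32) * ?sum \<le> 0" by (simp add: mult_nonneg_nonneg)
    also have "0 \<le> L / 2 * (1 - S / 2 - r)\<^sup>2" by simp
    finally show ?thesis by (simp add: e_def)
  next
    case False
    define B where "B = {v \<in> C. s v \<ge> 1 - e}"
    have uniq: "u = v" if "u \<in> B" "v \<in> B" for u v
    proof (rule ccontr)
      assume "u \<noteq> v"
      then have "s u + s v = (\<Sum>w\<in>{u, v}. s w)" by simp
      also have "\<dots> \<le> S" unfolding S using that fin s by (intro sum_mono2) (auto simp: B_def)
      finally have "2 * (1 - e) \<le> S" using that by (simp add: B_def)
      then show False using False e r by simp
    qed
    have sumB: "?sum = (\<Sum>v\<in>B. s v / 2 + S / 2 + r - 1)"
      unfolding B_def using fin by (simp add: sum.inter_filter of_bool_def if_distrib[of "\<lambda>x. x * _"])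
        (intro sum.cong, auto)
    have "?sum \<ge> - e"
    proof (cases "B = {}")
      case False
      then obtain v where "v \<in> B" by blast
      with uniq have "B = {v}" by blast
      moreover have "v \<in> C" "s v \<ge> 1 - e" using \<open>v \<in> B\<close> by (auto simp: B_def)
      ultimately show ?thesis using sumB sS[of v] r by simp
    qed (use sumB e in auto)
    then have "- ((real L)\<^sup>2 / 32) * ?sum \<le> (real L)\<^sup>2 / 32 * e"
      using mult_left_mono[of "- e" ?sum "(real L)\<^sup>2 / 32"] by simp
    also have "\<dots> = L / 2 * (1 / 4)\<^sup>2" using L by (simp add: e_def power2_eq_square field_simps)
    also have "\<dots> \<le> L / 2 * (1 - S / 2 - r)\<^sup>2"
      using False e by (intro mult_left_mono power_mono) auto
    finally show ?thesis by (simp add: e_def)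
  qed
qed

text \<open>The slope \<open>L / 2\<close> is chosen so that the linear prices in a clique add up to
  \<open>L * (1 - S / 2) = L * y\<close>. Multiplied by the common part \<open>r - y\<close> of the
  slack this gives \<open>L * y * (r - y)\<close>, which contains \<open>- L * (y - r)^2\<close>;
  half of that square is spent on the jump.\<close>

lemma clique_dual_bound:
  fixes s :: "nat \<Rightarrow> real" and L :: nat and r y S :: real
  assumes fin: "finite C" and card: "card C = L" and s: "\<And>v. v \<in> C \<Longrightarrow> 0 \<le> s v"
    and L: "L \<ge> 8" and r: "0 \<le> r" and S: "S = (\<Sum>v\<in>C. s v)" and y: "y = 1 - S / 2"
  shows "(\<Sum>v\<in>C. dual_price L (s v) * (s v / 2 + S / 2 + r - 1))
     \<le> S / 2 + L * y * (r - y) + L / 2 * (y - r)\<^sup>2"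
proof -
  have "(\<Sum>v\<in>C. dual_price L (s v) * (s v / 2 + S / 2 + r - 1))
      = (\<Sum>v\<in>C. s v / 2 - L / 4 * (s v)\<^sup>2 + (r - y) - L / 2 * (r - y) * s v
           + - ((real L)\<^sup>2 / 32) * (of_bool (s v \<ge> 1 - 1 / L) * (s v / 2 + S / 2 + r - 1)))"
    by (intro sum.cong) (auto simp: dual_price_def y field_simps power2_eq_square)
  also have "\<dots> = S / 2 - L / 4 * (\<Sum>v\<in>C. (s v)\<^sup>2) + L * (r - y) - L / 2 * (r - y) * S
       + - ((real L)\<^sup>2 / 32) * (\<Sum>v\<in>C. of_bool (s v \<ge> 1 - 1 / L) * (s v / 2 + S / 2 + r - 1))"
    unfolding sum.distrib sum_subtractf sum_distrib_left[symmetric] sum_divide_distrib[symmetric]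
    by (simp add: card S right_diff_distrib)
  also have "\<dots> \<le> S / 2 - 0 + L * (r - y) - L / 2 * (r - y) * S + L / 2 * (1 - S / 2 - r)\<^sup>2"
    by (intro add_mono diff_mono high_signal_slack_bound[OF fin s L r S]) (auto intro!: mult_nonneg_nonneg sum_nonneg)
  also have "\<dots> = S / 2 + L * y * (r - y) + L / 2 * (y - r)\<^sup>2"
    by (simp add: y field_simps)
  finally show ?thesis .
qed

text \<open>The term \<open>- L * r * T / 2\<close> matters: it will cancel an equal positive term
  from the cliques. Everything else apart from the jump is of order \<open>L + T\<close>, negligible
  against \<open>L^2\<close> and the cost.\<close>

lemma core_dual_bound:
  fixes c d T r :: real and L :: nat
  assumes "0 \<le> c" "c \<le> 1" "0 \<le> d" "d \<le> 1" "0 \<le> T" "r = (c + d) / 2"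
  defines "h \<equiv> (\<lambda>x. of_bool (x \<ge> 1 - 1 / L) * (x / 2 + r - 1 + T / 2))"
  shows "dual_price L c * (c / 2 + r - 1 + T / 2) + dual_price L d * (d / 2 + r - 1 + T / 2)
    \<le> 1 + L / 4 + T - L * r * T / 2 - (real L)\<^sup>2 / 32 * (h c + h d)"
proof -
  have "dual_price L c * (c / 2 + r - 1 + T / 2) + dual_price L d * (d / 2 + r - 1 + T / 2)
    = r - L / 4 * (c\<^sup>2 + d\<^sup>2) + (2 - L * r) * (r - 1) + T - L * r * T / 2 
      - (real L)\<^sup>2 / 32 * (h c + h d)"
  proof -
    obtain i j :: real where "of_bool (c \<ge> 1 - 1 / L) = i" "of_bool (d \<ge> 1 - 1 / L) = j" by blast
    then show ?thesis unfolding dual_price_def h_def assms(6) by (simp add: power2_eq_square field_simps)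
  qed
  moreover have "(2 - L * r) * (r - 1) \<le> L / 4"
  proof -
    have "r \<le> 1" using assms by simp
    moreover have "r * (1 - r) \<le> 1 / 4"
      using zero_le_power2[of "r - 1 / 2"] by (simp add: power2_eq_square algebra_simps)
    then have "L * (r * (1 - r)) \<le> L * (1 / 4)" by (intro mult_left_mono) auto
    ultimately show ?thesis by (simp add: algebra_simps)
  qed
  moreover have "L / 4 * (c\<^sup>2 + d\<^sup>2) \<ge> 0" by simp
  moreover have "r \<le> 1" using assms by simp
  ultimately show ?thesis by linarith
qed

section \<open>The hard instance: edge weights, a solution of size 2, and the slack of each kind of
  vertex\<close>

lemma weighted_graph_clique_graph: "weighted_graph (L ^ 3 + 2) (clique_graph L)"
  by (auto simp: weighted_graph_def clique_graph_def)

lemma edge_weights_eq_clique_graph: "edge_weights_eq (L ^ 3 + 2) (clique_graph L) (1/2)"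
  by (auto simp: edge_weights_eq_def clique_graph_def)

lemma OPT_IR_le:
  assumes "\<And>v. v < n \<Longrightarrow> \<theta> v \<le> 1" "feasible n W \<theta>"
  shows "OPT_IR n W \<le> (\<Sum>v<n. \<theta> v)"
  unfolding OPT_IR_def
proof (rule cInf_lower)
  show "bdd_below {\<Sum>v<n. \<theta> v |\<theta>. (\<forall>v<n. \<theta> v \<le> 1) \<and> feasible n W \<theta>}"
    by (intro bdd_belowI[of _ 0]) (auto simp: feasible_def intro!: sum_nonneg)
qed (use assms in auto)

lemma OPT_IR_clique_graph: "OPT_IR (L ^ 3 + 2) (clique_graph L) \<le> 2"
proof -
  define \<theta> :: "nat \<Rightarrow> real" where "\<theta> v = of_bool (L ^ 3 \<le> v)" for v
  have sum: "(\<Sum>v<L ^ 3 + 2. f v * \<theta> v) = f (L ^ 3) + f (Suc (L ^ 3))" for f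
  proof -
    have "(\<Sum>v<L ^ 3 + 2. f v * \<theta> v) = (\<Sum>v<L ^ 3. f v * \<theta> v) + f (L ^ 3) + f (Suc (L ^ 3))"
      by (simp add: numeral_2_eq_2 \<theta>_def)
    also have "(\<Sum>v<L ^ 3. f v * \<theta> v) = 0" by (auto simp: \<theta>_def)
    finally show ?thesis by simp
  qed
  have "feasible (L ^ 3 + 2) (clique_graph L) \<theta>"
    unfolding feasible_def sum by (auto simp: \<theta>_def clique_graph_def)
  then have "OPT_IR (L ^ 3 + 2) (clique_graph L) \<le> (\<Sum>v<L ^ 3 + 2. \<theta> v)"
    by (rule OPT_IR_le[rotated]) (simp add: \<theta>_def)
  also have "\<dots> = 2" using sum[of "\<lambda>_. 1"] by simp
  finally show ?thesis .
qed

text \<open>Splitting the own weight 1 into two halves gives core and clique vertices the same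
  shape: half the own signal plus half the total signal of the closed neighbourhood.\<close>

lemma slack_clique_graph_core:
  assumes c: "c = L ^ 3 \<or> c = Suc (L ^ 3)"
  shows "slack (L ^ 3 + 2) (clique_graph L) s c
    = s c / 2 + (s (L ^ 3) + s (Suc (L ^ 3))) / 2 - 1 + (\<Sum>v<L ^ 3. s v) / 2"
proof -
  have "(\<Sum>u<L ^ 3. clique_graph L c u * s u) = (\<Sum>u<L ^ 3. s u / 2)"
    using c by (intro sum.cong) (auto simp: clique_graph_def)
  then show ?thesis using c
    by (auto simp: slack_def numeral_2_eq_2 sum_divide_distrib clique_graph_def field_simps)
qed

lemma slack_clique_graph_block:
  assumes L: "L > 0" and j: "j < L ^ 2" and v: "v \<in> {j * L..<j * L + L}"
  shows "slack (L ^ 3 + 2) (clique_graph L) s v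
    = s v / 2 + (\<Sum>u\<in>{j * L..<j * L + L}. s u) / 2 + (s (L ^ 3) + s (Suc (L ^ 3))) / 2 - 1"
proof -
  have div_iff: "u div L = j \<longleftrightarrow> u \<in> {j * L..<j * L + L}" for u
  proof
    assume "u div L = j"
    then have "u = j * L + u mod L" by (metis div_mult_mod_eq)
    then show "u \<in> {j * L..<j * L + L}" using mod_less_divisor[OF L, of u]
      by (metis add_less_cancel_left atLeastLessThan_iff le_add1)
  qed (intro div_nat_eqI, auto simp: mult.commute)
  have "Suc j * L \<le> L ^ 2 * L" using j by (intro mult_right_mono) auto
  then have sub: "{j * L..<j * L + L} \<subseteq> {..<L ^ 3}"
    by (auto simp: power3_eq_cube power2_eq_square)
  have vj: "v div L = j" "v < L ^ 3" using v sub div_iff by auto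
  have "(\<Sum>u<L ^ 3. clique_graph L v u * s u)
      = (\<Sum>u<L ^ 3. (if u = v then s u / 2 else 0) + (if u \<in> {j * L..<j * L + L} then s u / 2 else 0))"
    using vj v by (intro sum.cong) (auto simp: clique_graph_def simp flip: div_iff simp del: atLeastLessThan_iff)
  also have "\<dots> = s v / 2 + (\<Sum>u\<in>{j * L..<j * L + L}. s u / 2)"
    unfolding sum.distrib using vj sub
    by (simp add: Int_absorb1 flip: sum.inter_restrict del: atLeastLessThan_iff)
  finally show ?thesis using vj
    by (auto simp: slack_def numeral_2_eq_2 clique_graph_def sum_divide_distrib)
qed

lemma clique_graph_dual_feasible:
  fixes s :: "nat \<Rightarrow> real"
  assumes L: "L \<ge> 200" and s: "\<And>v. v < L ^ 3 + 2 \<Longrightarrow> 0 \<le> s v \<and> s v \<le> 1"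
  shows "(\<Sum>v<L ^ 3 + 2. dual_price L (s v) * slack (L ^ 3 + 2) (clique_graph L) s v)
      \<le> 4 * (\<Sum>v<L ^ 3 + 2. s v) - (real L)\<^sup>2 / 128"
proof -
  define c d where "c = s (L ^ 3)" and "d = s (Suc (L ^ 3))"
  define r where "r = (c + d) / 2"
  define T where "T = (\<Sum>v<L ^ 3. s v)"
  define C where "C j = {j * L..<j * L + L}" for j
  define S where "S j = (\<Sum>v\<in>C j. s v)" for j
  define y where "y j = 1 - S j / 2" for j
  define h where "h x = of_bool (x \<ge> 1 - 1 / L) * (x / 2 + r - 1 + T / 2)" for x
  let ?sl = "slack (L ^ 3 + 2) (clique_graph L) s"
  have cube: "L ^ 3 = L ^ 2 * L" by (simp add: power3_eq_cube power2_eq_square)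
  have blocks: "(\<Sum>v<L ^ 3. f v) = (\<Sum>j<L ^ 2. \<Sum>v\<in>C j. f v)" for f :: "nat \<Rightarrow> real"
    unfolding cube C_def by (rule sum.nat_group[symmetric])
  have in_C: "v < L ^ 3" if "j < L ^ 2" "v \<in> C j" for v j
  proof -
    have "Suc j * L \<le> L ^ 2 * L" using that by (intro mult_right_mono) auto
    then show ?thesis using that by (auto simp: C_def cube)
  qed
  have cd: "0 \<le> c" "c \<le> 1" "0 \<le> d" "d \<le> 1" using s by (auto simp: c_def d_def)
  have r: "0 \<le> r" "r \<le> 1" using cd by (auto simp: r_def)
  have T0: "T \<ge> 0" unfolding T_def using s by (intro sum_nonneg) auto
  have S0: "S j \<ge> 0" if "j < L ^ 2" for j
    unfolding S_def using s in_C[OF that] by (intro sum_nonneg) fastforce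
  have T_blocks: "T = (\<Sum>j<L ^ 2. S j)" by (simp add: T_def blocks S_def)
  have Lr: "real L \<ge> 200" using L by simp
  have split: "(\<Sum>v<L ^ 3 + 2. f v) = (\<Sum>v<L ^ 3. f v) + (f (L ^ 3) + f (Suc (L ^ 3)))"
    for f :: "nat \<Rightarrow> real" by (simp add: numeral_2_eq_2)
  have total: "(\<Sum>v<L ^ 3 + 2. dual_price L (s v) * ?sl v) =
      (\<Sum>j<L ^ 2. \<Sum>v\<in>C j. dual_price L (s v) * ?sl v)
      + (dual_price L c * (c / 2 + r - 1 + T / 2) + dual_price L d * (d / 2 + r - 1 + T / 2))"
    unfolding split blocks[symmetric] slack_clique_graph_core[OF disjI1[OF refl]]
      slack_clique_graph_core[OF disjI2[OF refl]] c_def d_def r_def T_def by simp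
  have "(\<Sum>j<L ^ 2. \<Sum>v\<in>C j. dual_price L (s v) * ?sl v)
      = (\<Sum>j<L ^ 2. \<Sum>v\<in>C j. dual_price L (s v) * (s v / 2 + S j / 2 + r - 1))"
  proof (intro sum.cong refl)
    fix j v assume "j \<in> {..<L ^ 2}" "v \<in> C j"
    then show "dual_price L (s v) * ?sl v = dual_price L (s v) * (s v / 2 + S j / 2 + r - 1)"
      using slack_clique_graph_block[of L j v s] L by (simp add: C_def S_def r_def c_def d_def)
  qed
  also have "\<dots> \<le> (\<Sum>j<L ^ 2. S j / 2 + L * y j * (r - y j) + L / 2 * (y j - r)\<^sup>2)"
  proof (intro sum_mono clique_dual_bound)
    fix j v assume "j \<in> {..<L ^ 2}" "v \<in> C j"
    then show "0 \<le> s v" using in_C[of j v] s[of v] by simp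
  qed (use L r in \<open>auto simp: C_def S_def y_def\<close>)
  \<comment> \<open>Substituting \<open>y j = 1 - S j / 2\<close> in
    \<open>L * y j * (r - y j)\<close> yields the square, the term \<open>r * (1 - r)\<close> and
    the cross term \<open>L * r * S j / 2\<close>, which the core cancels.\<close>
  also have "\<dots> = (\<Sum>j<L ^ 2. S j / 2 + L * r * S j / 2 - L / 2 * (y j - r)\<^sup>2 - L * (r * (1 - r)))"
    by (intro sum.cong) (auto simp: y_def power2_eq_square field_simps)
  also have "\<dots> = T / 2 + L * r * T / 2 - (\<Sum>j<L ^ 2. L / 2 * (y j - r)\<^sup>2) - real L ^ 3 * (r * (1 - r))"
    by (simp add: T_blocks sum.distrib sum_subtractf sum_distrib_left sum_divide_distrib
        power2_eq_square power3_eq_cube)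
  finally have cliques: "(\<Sum>j<L ^ 2. \<Sum>v\<in>C j. dual_price L (s v) * ?sl v) \<le> \<dots>" .
  have core: "dual_price L c * (c / 2 + r - 1 + T / 2) + dual_price L d * (d / 2 + r - 1 + T / 2)
      \<le> 1 + L / 4 + T - L * r * T / 2 - (real L)\<^sup>2 / 32 * (h c + h d)"
    unfolding h_def using cd T0 by (intro core_dual_bound) (auto simp: r_def)
  have main: "(\<Sum>v<L ^ 3 + 2. dual_price L (s v) * ?sl v)
     \<le> 3 / 2 * T + 1 + L / 4 - (real L)\<^sup>2 / 32 * (h c + h d)
       - (\<Sum>j<L ^ 2. L / 2 * (y j - r)\<^sup>2) - real L ^ 3 * (r * (1 - r))"
    unfolding total using cliques core by linarith
  have hge: "h x \<ge> - (1 / L)" if "x = c \<or> x = d" for x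
  proof (cases "x \<ge> 1 - 1 / L")
    case True
    have "r \<ge> x / 2" using that cd by (auto simp: r_def)
    with True T0 show ?thesis by (simp add: h_def)
  qed (simp add: h_def)
  have hneg: "- ((real L)\<^sup>2 / 32 * (h c + h d)) \<le> L / 16"
  proof -
    have "(real L)\<^sup>2 / 32 * - (2 / L) \<le> (real L)\<^sup>2 / 32 * (h c + h d)"
      using hge[of c] hge[of d] by (intro mult_left_mono) auto
    then show ?thesis using Lr by (simp add: power2_eq_square)
  qed
  have ysq: "(\<Sum>j<L ^ 2. L / 2 * (y j - r)\<^sup>2) \<ge> 0" by (intro sum_nonneg) auto
  have rr: "real L ^ 3 * (r * (1 - r)) \<ge> 0" using r by simp
  have LL: "(real L)\<^sup>2 \<ge> 200 * real L"
    using Lr by (simp add: power2_eq_square mult_right_mono)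
  have "3 / 2 * T + 1 + L / 4 - (real L)\<^sup>2 / 32 * (h c + h d)
       - (\<Sum>j<L ^ 2. L / 2 * (y j - r)\<^sup>2) - real L ^ 3 * (r * (1 - r)) \<le> 4 * T - (real L)\<^sup>2 / 128"
  proof -
    \<comment> \<open>Each range of \<open>r\<close> has its own source of a loss of order
      \<open>L^2\<close>: the jump at the core vertices, the term
      \<open>L ^ 3 * (r * (1 - r))\<close>, and the squares of the cliques.\<close>
    consider "r \<ge> 1 - 1 / (2 * L)" | "1 / 2 \<le> r" "r < 1 - 1 / (2 * L)" | "r < 1 / 2" by linarith
    then show ?thesis
    proof cases
      case 1
      have e: "1 / real L \<le> 1 / 200" using Lr by (simp add: field_simps)
      have "h x \<ge> 1 / 4" if "x = c \<or> x = d" for x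
      proof -
        \<comment> \<open>Two numbers at most 1 whose mean is within \<open>1 / (2 * L)\<close> of 1
          are each within \<open>1 / L\<close> of 1, which is the threshold in
          \<open>dual_price\<close>.\<close>
        have "x \<ge> 1 - 1 / L" using that cd 1 by (auto simp: r_def field_simps)
        then show ?thesis using 1 T0 e by (simp add: h_def)
      qed
      from this[of c] this[of d] have "h c + h d \<ge> 1 / 2" by simp
      then have "(real L)\<^sup>2 / 32 * (h c + h d) \<ge> (real L)\<^sup>2 / 32 * (1 / 2)"
        by (intro mult_left_mono) auto
      then show ?thesis using ysq rr LL Lr T0 by linarith
    next
      case 2
      have "(1 / 2) * (1 / (2 * L)) \<le> r * (1 - r)" using 2 by (intro mult_mono) auto
      then have "real L ^ 3 * ((1 / 2) * (1 / (2 * L))) \<le> real L ^ 3 * (r * (1 - r))"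
        by (intro mult_left_mono) auto
      moreover have "real L ^ 3 * ((1 / 2) * (1 / (2 * L))) = (real L)\<^sup>2 / 4"
        using Lr by (simp add: power2_eq_square power3_eq_cube)
      ultimately show ?thesis using hneg ysq LL Lr T0 by linarith
    next
      case 3
      \<comment> \<open>A clique either has signal at least 1/2, or \<open>y j\<close> exceeds 3/4
        and its square alone is worth \<open>L / 32\<close>, at least 1. The resulting
        \<open>2 * T\<close> on top of \<open>3 / 2 * T\<close> explains the factor 4.\<close>
      have "(\<Sum>j<L ^ 2. 1 - 2 * S j) \<le> (\<Sum>j<L ^ 2. L / 2 * (y j - r)\<^sup>2)"
      proof (intro sum_mono)
        fix j assume "j \<in> {..<L ^ 2}"
        then have j: "j < L ^ 2" by simp
        show "1 - 2 * S j \<le> L / 2 * (y j - r)\<^sup>2"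
        proof (cases "S j \<ge> 1 / 2")
          case True
          then have "1 - 2 * S j \<le> 0" by simp
          also have "0 \<le> L / 2 * (y j - r)\<^sup>2" by simp
          finally show ?thesis .
        next
          case False
          have "(1 / 4)\<^sup>2 \<le> (y j - r)\<^sup>2" using False 3 by (intro power_mono) (auto simp: y_def)
          then have "L / 2 * (1 / 4)\<^sup>2 \<le> L / 2 * (y j - r)\<^sup>2" by (intro mult_left_mono) auto
          moreover have "L / 2 * (1 / 4)\<^sup>2 \<ge> 1" using Lr by (simp add: power2_eq_square)
          ultimately show ?thesis using S0[OF j] by linarith
        qed
      qed
      moreover have "(\<Sum>j<L ^ 2. 1 - 2 * S j) = (real L)\<^sup>2 - 2 * T"
        by (simp add: T_blocks sum_subtractf sum_distrib_left)
      ultimately show ?thesis using hneg rr LL Lr T0 by linarith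
    qed
  qed
  moreover have "T \<le> (\<Sum>v<L ^ 3 + 2. s v)"
    using cd by (simp add: split T_def c_def d_def del: add_2_eq_Suc')
  ultimately show ?thesis using main by linarith
qed

text \<open>Duality gives cost at least \<open>L^2 / 512\<close>, and \<open>n powr (2/3)\<close> is
  at most \<open>2 * L^2\<close> for \<open>n = L ^ 3 + 2\<close>; hence 1/1024.\<close>

lemma clique_graph_cost:
  assumes L: "L \<ge> 200" and sch: "signaling_scheme (L ^ 3 + 2) S \<phi>"
    and per: "persuasive (L ^ 3 + 2) (clique_graph L) S \<phi>"
  shows "cost (L ^ 3 + 2) \<phi> \<ge> 1 / 1024 * real (L ^ 3 + 2) powr (2/3)"
proof -
  have "dual_price L 0 \<ge> 0" using L by (simp add: dual_price_def field_simps)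
  then have "(real L)\<^sup>2 / 128 \<le> 4 * cost (L ^ 3 + 2) \<phi>"
    using clique_graph_dual_feasible[OF L]
    by (rule cost_lower_bound_dual[where g = "dual_price L", OF weighted_graph_clique_graph sch per])
  moreover have "real (L ^ 3 + 2) powr (2/3) \<le> 2 * (real L)\<^sup>2"
  proof -
    have "2 \<le> L ^ 3" using L power_increasing[of 1 3 L] by simp
    then have "real (L ^ 3 + 2) \<le> 2 * real L ^ 3" using of_nat_mono[of 2 "L ^ 3", where 'a = real] by simp
    then have "real (L ^ 3 + 2) powr (2/3) \<le> (2 * real L ^ 3) powr (2/3)" by (intro powr_mono2) auto
    also have "\<dots> = 2 powr (2/3) * (real L ^ 3) powr (2/3)" by (simp add: powr_mult)
    also have "(real L ^ 3) powr (2/3) = (real L)\<^sup>2"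
    proof -
      have "(real L ^ 3) powr (2/3) = (real L powr 3) powr (2/3)" using L by simp
      also have "\<dots> = real L powr (3 * (2/3))" by (rule powr_powr)
      finally show ?thesis using L by simp
    qed
    finally have "real (L ^ 3 + 2) powr (2/3) \<le> 2 powr (2/3) * (real L)\<^sup>2" .
    also have "\<dots> \<le> 2 powr 1 * (real L)\<^sup>2" by (intro mult_right_mono powr_mono) auto
    finally show ?thesis by simp
  qed
  ultimately show ?thesis by simp
qed

section \<open>Schemes from random vertex sets\<close>

text \<open>Composition with a transposition of agents permutes the profiles, so the sum is the same
  for all agents; their average is found from bijectivity.\<close>

lemma sum_profiles_apply:
  fixes g :: "nat \<Rightarrow> real"
  assumes i: "i < n"
  shows "(\<Sum>t\<in>profiles n. g (t i)) = card (profiles n) / n * (\<Sum>v<n. g v)"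
proof -
  have "(\<Sum>t\<in>profiles n. g (t j)) = (\<Sum>t\<in>profiles n. g (t i))" if "j < n" for j
    unfolding profiles_def
    by (subst sum_permutations_compose_right[OF permutes_swap_id[of i _ j]]) (use i that in auto)
  then have "n * (\<Sum>t\<in>profiles n. g (t i)) = (\<Sum>j<n. \<Sum>t\<in>profiles n. g (t j))" by simp
  also have "\<dots> = (\<Sum>t\<in>profiles n. \<Sum>j<n. g (t j))" by (rule sum.swap)
  also have "\<dots> = (\<Sum>t\<in>profiles n. \<Sum>v<n. g v)"
  proof (rule sum.cong[OF refl])
    fix t assume "t \<in> profiles n"
    then show "(\<Sum>j<n. g (t j)) = (\<Sum>v<n. g v)"
      using sum.permute[of t "{..<n}" g] by (simp add: profiles_def o_def)
  qed
  finally show ?thesis using i by (simp add: field_simps)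
qed

lemma expectation_joint_const:
  fixes h :: "(nat \<Rightarrow> nat) \<Rightarrow> (nat \<Rightarrow> real) \<Rightarrow> real"
  assumes fin: "finite (set_pmf D)"
  shows "measure_pmf.expectation (joint n (\<lambda>_. D)) (\<lambda>(t, s). h t s)
    = (\<Sum>t\<in>profiles n. measure_pmf.expectation D (h t)) / card (profiles n)"
  unfolding joint_def using fin
  by (subst pmf_expectation_bind_pmf_of_set) (auto simp: sum_divide_distrib field_simps)

text \<open>If the scheme ignores the profile, an agent's type is uniform and independent of the
  signals. All agents then face the same constraints, stated on vertices alone.\<close>

lemma slack_moment_const:
  assumes fin: "finite (set_pmf D)" and i: "i < n"
  shows "slack_moment n W (\<lambda>_. D) i \<theta>
    = measure_pmf.expectation D (\<lambda>s. \<Sum>v<n. of_bool (s v = \<theta>) * slack n W s v) / n"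
proof -
  have "card (profiles n) > 0" by (simp add: card_gt_0_iff)
  then show ?thesis
    unfolding slack_moment_def expectation_joint_const[OF fin]
    using sum_profiles_apply[OF i, of "\<lambda>v. measure_pmf.expectation D (\<lambda>s. of_bool (s v = \<theta>) * slack n W s v)"]
    by (simp add: integrable_measure_pmf_finite[OF fin] del: sum_of_bool_mult_eq)
qed

lemma cost_const:
  assumes "finite (set_pmf D)"
  shows "cost n (\<lambda>_. D) = measure_pmf.expectation D (\<lambda>s. \<Sum>v<n. \<bar>s v\<bar>)"
proof -
  have "card (profiles n) > 0" by (simp add: card_gt_0_iff)
  then show ?thesis unfolding cost_def expectation_joint_const[OF assms] by simp
qed

lemma exists_signal_space:
  fixes a b :: real
  assumes "0 < a" "a \<le> 1" "0 < b" "b \<le> 1"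
  obtains S where "card S = 3" "{0, a, b} \<subseteq> S" "S \<subseteq> {0..1}"
proof (cases "a = b")
  case True
  \<comment> \<open>\<open>a / 2\<close> is never sent; it only pads the signal space to three
    elements.\<close>
  show ?thesis by (rule that[of "{0, a, a / 2}"]) (use assms True in auto)
next
  case False
  show ?thesis by (rule that[of "{0, a, b}"]) (use assms False in auto)
qed

text \<open>When no \<open>a\<close>-vertex is adjacent to a \<open>b\<close>-vertex, the tightness conditions decouple and simply
  prescribe \<open>a\<close> and \<open>b\<close> as ratios of expectations. This also covers the degenerate case \<open>a = b\<close>.\<close>

lemma scheme_of_random_sets:
  fixes P :: "'w pmf" and A B :: "'w \<Rightarrow> nat set"
  defines "E \<equiv> (\<lambda>f. measure_pmf.expectation P (f :: 'w \<Rightarrow> real))"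
  assumes W: "weighted_graph n W" and fin: "finite (set_pmf P)"
    and A: "\<And>\<omega>. A \<omega> \<subseteq> {..<n}" and B: "\<And>\<omega>. B \<omega> \<subseteq> {..<n}" and AB: "\<And>\<omega>. A \<omega> \<inter> B \<omega> = {}"
    and nonadj: "\<And>\<omega> u v. u \<in> A \<omega> \<Longrightarrow> v \<in> B \<omega> \<Longrightarrow> W u v = 0"
    and a: "0 < a" "a \<le> 1" and b: "0 < b" "b \<le> 1"
    and tight_a: "a * E (\<lambda>\<omega>. \<Sum>u\<in>A \<omega>. \<Sum>v\<in>A \<omega>. W u v) = E (\<lambda>\<omega>. card (A \<omega>))"
    and tight_b: "b * E (\<lambda>\<omega>. \<Sum>u\<in>B \<omega>. \<Sum>v\<in>B \<omega>. W u v) = E (\<lambda>\<omega>. card (B \<omega>))"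
    and zero: "0 \<le> E (\<lambda>\<omega>. \<Sum>v\<in>{..<n} - A \<omega> - B \<omega>.
                       a * (\<Sum>u\<in>A \<omega>. W v u) + b * (\<Sum>u\<in>B \<omega>. W v u) - 1)"
  shows "\<exists>S \<phi>. card S = 3 \<and> signaling_scheme n S \<phi> \<and> persuasive n W S \<phi> \<and>
           cost n \<phi> = a * E (\<lambda>\<omega>. card (A \<omega>)) + b * E (\<lambda>\<omega>. card (B \<omega>))"
proof -
  note int [simp] = integrable_measure_pmf_finite[OF fin]
  have finA [simp]: "finite (A \<omega>)" and finB [simp]: "finite (B \<omega>)" for \<omega>
    using A B by (meson finite_lessThan finite_subset)+
  obtain S where S: "card S = 3" "{0, a, b} \<subseteq> S" "S \<subseteq> {0..1}"
    using exists_signal_space[OF a b] by blast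
  define s where "s \<omega> v = (if v \<in> A \<omega> then a else if v \<in> B \<omega> then b else 0)" for \<omega> v
  define D where "D = map_pmf s P"
  have finD: "finite (set_pmf D)" using fin by (simp add: D_def)
  have sums: "(\<Sum>u<n. f u (s \<omega> u)) = (\<Sum>u\<in>A \<omega>. f u a) + (\<Sum>u\<in>B \<omega>. f u b)
      + (\<Sum>u\<in>{..<n} - A \<omega> - B \<omega>. f u 0)" for f :: "nat \<Rightarrow> real \<Rightarrow> real" and \<omega>
  proof -
    have "{..<n} = (A \<omega> \<union> B \<omega>) \<union> ({..<n} - A \<omega> - B \<omega>)" using A B by blast
    then have "(\<Sum>u<n. f u (s \<omega> u)) = (\<Sum>u\<in>A \<omega> \<union> B \<omega>. f u (s \<omega> u)) 
        + (\<Sum>u\<in>{..<n} - A \<omega> - B \<omega>. f u (s \<omega> u))"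
      by (subst (1) \<open>{..<n} = _\<close>, subst sum.union_disjoint) auto
    also have "(\<Sum>u\<in>A \<omega> \<union> B \<omega>. f u (s \<omega> u)) = (\<Sum>u\<in>A \<omega>. f u (s \<omega> u)) + (\<Sum>u\<in>B \<omega>. f u (s \<omega> u))"
      using AB by (intro sum.union_disjoint) auto
    also have "(\<Sum>u\<in>A \<omega>. f u (s \<omega> u)) = (\<Sum>u\<in>A \<omega>. f u a)" by (simp add: s_def)
    also have "(\<Sum>u\<in>B \<omega>. f u (s \<omega> u)) = (\<Sum>u\<in>B \<omega>. f u b)"
      using AB by (intro sum.cong) (auto simp: s_def)
    also have "(\<Sum>u\<in>{..<n} - A \<omega> - B \<omega>. f u (s \<omega> u)) = (\<Sum>u\<in>{..<n} - A \<omega> - B \<omega>. f u 0)"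
      by (simp add: s_def)
    finally show ?thesis .
  qed
  have sch: "signaling_scheme n S (\<lambda>_. D)"
  proof -
    have "s \<omega> v \<in> S" for \<omega> v using S by (simp add: s_def)
    moreover have "s \<omega> v = 0" if "n \<le> v" for \<omega> v
      using that A[of \<omega>] B[of \<omega>] by (auto simp: s_def)
    moreover have "finite S" using S(1) by (intro card_ge_0_finite) simp
    ultimately show ?thesis using S unfolding signaling_scheme_def D_def by auto
  qed
  have slack_eq: "slack n W (s \<omega>) v = a * (\<Sum>u\<in>A \<omega>. W v u) + b * (\<Sum>u\<in>B \<omega>. W v u) - 1" for \<omega> v
    unfolding slack_def using sums[of "\<lambda>u x. W v u * x" \<omega>]
    by (simp add: sum_distrib_left mult.commute)
  have sym: "W u v = W v u" if "u < n" "v < n" for u v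
    using W that by (auto simp: weighted_graph_def)
  have slack_A: "(\<Sum>v\<in>A \<omega>. slack n W (s \<omega>) v) = a * (\<Sum>u\<in>A \<omega>. \<Sum>v\<in>A \<omega>. W u v) - card (A \<omega>)" for \<omega>
    using nonadj by (simp add: slack_eq sum_subtractf sum.distrib sum_distrib_left)
  have slack_B: "(\<Sum>v\<in>B \<omega>. slack n W (s \<omega>) v) = b * (\<Sum>u\<in>B \<omega>. \<Sum>v\<in>B \<omega>. W u v) - card (B \<omega>)" for \<omega>
  proof -
    have "W v u = 0" if "u \<in> A \<omega>" "v \<in> B \<omega>" for u v
      using nonadj[OF that] sym[of u v] that A B by fastforce
    then show ?thesis by (simp add: slack_eq sum_subtractf sum.distrib sum_distrib_left)
  qed
  have moment: "measure_pmf.expectation D (\<lambda>s. \<Sum>v<n. of_bool (s v = \<theta>) * slack n W s v)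
      = of_bool (\<theta> = 0) * E (\<lambda>\<omega>. \<Sum>v\<in>{..<n} - A \<omega> - B \<omega>.
                       a * (\<Sum>u\<in>A \<omega>. W v u) + b * (\<Sum>u\<in>B \<omega>. W v u) - 1)" for \<theta>
  proof -
    have "measure_pmf.expectation D (\<lambda>s. \<Sum>v<n. of_bool (s v = \<theta>) * slack n W s v)
      = E (\<lambda>\<omega>. of_bool (a = \<theta>) * (a * (\<Sum>u\<in>A \<omega>. \<Sum>v\<in>A \<omega>. W u v) - card (A \<omega>))
         + of_bool (b = \<theta>) * (b * (\<Sum>u\<in>B \<omega>. \<Sum>v\<in>B \<omega>. W u v) - card (B \<omega>))
         + of_bool (0 = \<theta>) * (\<Sum>v\<in>{..<n} - A \<omega> - B \<omega>. slack n W (s \<omega>) v))"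
      unfolding D_def E_def integral_map_pmf slack_A[symmetric] slack_B[symmetric]
      using sums[of "\<lambda>v x. of_bool (x = \<theta>) * slack n W (s \<omega>) v" \<omega> for \<omega>]
      by (simp add: sum_distrib_left)
    also have "\<dots> = of_bool (a = \<theta>) * (a * E (\<lambda>\<omega>. \<Sum>u\<in>A \<omega>. \<Sum>v\<in>A \<omega>. W u v) - E (\<lambda>\<omega>. card (A \<omega>)))
         + of_bool (b = \<theta>) * (b * E (\<lambda>\<omega>. \<Sum>u\<in>B \<omega>. \<Sum>v\<in>B \<omega>. W u v) - E (\<lambda>\<omega>. card (B \<omega>)))
         + of_bool (0 = \<theta>) * E (\<lambda>\<omega>. \<Sum>v\<in>{..<n} - A \<omega> - B \<omega>. slack n W (s \<omega>) v)"
      unfolding E_def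
      by (simp only: int Bochner_Integration.integral_add Bochner_Integration.integral_diff
          integral_mult_right_zero)
    finally show ?thesis by (auto simp: tight_a tight_b slack_eq)
  qed
  have "persuasive n W S (\<lambda>_. D)"
    unfolding persuasive_iff_slack_moment[OF W sch]
    using zero by (auto simp: slack_moment_const[OF finD] moment simp del: sum_of_bool_mult_eq)
  moreover have "cost n (\<lambda>_. D) = a * E (\<lambda>\<omega>. card (A \<omega>)) + b * E (\<lambda>\<omega>. card (B \<omega>))"
    unfolding cost_const[OF finD] unfolding D_def integral_map_pmf sums[of "\<lambda>_. abs"] E_def
    using a b by (simp add: mult.commute)
  ultimately show ?thesis using S(1) sch by blast
qed

text \<open>With \<open>n\<close> divided by the total weight as the signal of every vertex, the
  slack averages to 0 over all vertices, which is tightness for the only signal sent.\<close>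

lemma constant_signal_scheme:
  assumes W: "weighted_graph n W" and n: "n > 0"
  shows "\<exists>S \<phi>. card S = 3 \<and> signaling_scheme n S \<phi> \<and> persuasive n W S \<phi> \<and>
           cost n \<phi> = (real n)\<^sup>2 / (\<Sum>u<n. \<Sum>v<n. W u v)"
    and "(\<Sum>u<n. \<Sum>v<n. W u v) \<ge> n"
proof -
  have "W u u \<le> (\<Sum>v<n. W u v)" if "u < n" for u
    using that W by (intro member_le_sum) (auto simp: weighted_graph_def)
  then have "(\<Sum>u<n. 1) \<le> (\<Sum>u<n. \<Sum>v<n. W u v)"
    using W by (intro sum_mono) (auto simp: weighted_graph_def)
  then show ge: "(\<Sum>u<n. \<Sum>v<n. W u v) \<ge> n" by simp
  show "\<exists>S \<phi>. card S = 3 \<and> signaling_scheme n S \<phi> \<and> persuasive n W S \<phi> \<and>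
           cost n \<phi> = (real n)\<^sup>2 / (\<Sum>u<n. \<Sum>v<n. W u v)"
    using scheme_of_random_sets[OF W, of "return_pmf ()" "\<lambda>_. {..<n}" "\<lambda>_. {}"
        "n / (\<Sum>u<n. \<Sum>v<n. W u v)" 1] n ge
    by (simp add: power2_eq_square field_simps)
qed

text \<open>Since \<open>OPT_IR\<close> is at least 1, it lies strictly below its double. A solution
  within factor 2 thus exists without a proof that the infimum is attained.\<close>

lemma near_optimal_IR:
  assumes W: "weighted_graph n W" and n: "n > 0"
  obtains \<theta> where "\<And>v. v < n \<Longrightarrow> 0 \<le> \<theta> v" "\<And>v. v < n \<Longrightarrow> \<theta> v \<le> 1"
    "feasible n W \<theta>" "1 \<le> (\<Sum>v<n. \<theta> v)" "(\<Sum>v<n. \<theta> v) \<le> 2 * OPT_IR n W"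
proof -
  let ?X = "{(\<Sum>v<n. \<theta> v) | \<theta>. (\<forall>v<n. \<theta> v \<le> 1) \<and> feasible n W \<theta>}"
  have ge1: "1 \<le> (\<Sum>v<n. \<theta> v)" if "feasible n W \<theta>" for \<theta>
  proof -
    have "1 \<le> (\<Sum>v<n. W 0 v * \<theta> v)" using that n by (auto simp: feasible_def)
    also have "\<dots> \<le> (\<Sum>v<n. 1 * \<theta> v)"
      using that W n by (intro sum_mono mult_right_mono) (auto simp: feasible_def weighted_graph_def)
    finally show ?thesis by simp
  qed
  have "W u u \<le> (\<Sum>v<n. W u v)" if "u < n" for u
    using that W by (intro member_le_sum) (auto simp: weighted_graph_def)
  then have "feasible n W (\<lambda>_. 1)" using W by (auto simp: feasible_def weighted_graph_def)
  then have mem: "real n \<in> ?X" by (auto intro!: exI[of _ "\<lambda>_. 1"])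
  have bdd: "bdd_below ?X" using ge1 by (intro bdd_belowI[of _ 1]) auto
  have "1 \<le> OPT_IR n W" unfolding OPT_IR_def using mem ge1 by (intro cInf_greatest) auto
  then have "Inf ?X < 2 * OPT_IR n W" by (simp add: OPT_IR_def)
  then obtain \<theta> where "\<forall>v<n. \<theta> v \<le> 1" "feasible n W \<theta>" "(\<Sum>v<n. \<theta> v) < 2 * OPT_IR n W"
    using cInf_less_iff[of ?X] mem bdd by blast
  then show ?thesis using that[of \<theta>] ge1[of \<theta>] by (auto simp: feasible_def)
qed

section \<open>Random vertex labels\<close>

definition tri_pmf :: "real \<Rightarrow> real \<Rightarrow> nat pmf" where
  "tri_pmf p q = pmf_of_list [(0, 1 - p - q), (1, p), (2, q)]"

lemma
  fixes f :: "nat \<Rightarrow> real"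
  assumes "0 \<le> p" "0 \<le> q" "p + q \<le> 1"
  shows set_tri_pmf: "set_pmf (tri_pmf p q) \<subseteq> {0, 1, 2}"
    and pmf_tri_pmf: "pmf (tri_pmf p q) 0 = 1 - p - q" "pmf (tri_pmf p q) 1 = p" "pmf (tri_pmf p q) 2 = q"
    and expectation_tri_pmf:
      "measure_pmf.expectation (tri_pmf p q) f = (1 - p - q) * f 0 + p * f 1 + q * f 2"
proof -
  have wf: "pmf_of_list_wf [(0::nat, 1 - p - q), (1, p), (2, q)]"
    using assms by (auto simp: pmf_of_list_wf_def)
  show set: "set_pmf (tri_pmf p q) \<subseteq> {0, 1, 2}"
    unfolding tri_pmf_def using set_pmf_of_list[OF wf] by auto
  show pmfs: "pmf (tri_pmf p q) 0 = 1 - p - q" "pmf (tri_pmf p q) 1 = p" "pmf (tri_pmf p q) 2 = q"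
    unfolding tri_pmf_def pmf_pmf_of_list[OF wf] by simp_all
  have "measure_pmf.expectation (tri_pmf p q) f = (\<Sum>x\<in>{0, 1, 2}. pmf (tri_pmf p q) x *\<^sub>R f x)"
    using set by (intro integral_measure_pmf) auto
  then show "measure_pmf.expectation (tri_pmf p q) f = (1 - p - q) * f 0 + p * f 1 + q * f 2"
    by (simp add: pmfs[simplified])
qed

lemma expectation_pair_tri_pmf:
  fixes f :: "nat \<times> 'a \<Rightarrow> real"
  assumes "0 \<le> p" "0 \<le> q" "p + q \<le> 1" "finite (set_pmf L)"
  defines "E \<equiv> measure_pmf.expectation L"
  shows "measure_pmf.expectation (pair_pmf (tri_pmf p q) L) f =
    (1 - p - q) * E (\<lambda>\<omega>. f (0, \<omega>)) + p * E (\<lambda>\<omega>. f (1, \<omega>)) + q * E (\<lambda>\<omega>. f (2, \<omega>))"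
proof -
  have "pair_pmf (tri_pmf p q) L = bind_pmf (tri_pmf p q) (\<lambda>c. map_pmf (Pair c) L)"
    by (simp add: pair_pmf_def map_pmf_def)
  then have "measure_pmf.expectation (pair_pmf (tri_pmf p q) L) f =
      (\<Sum>c\<in>{0, 1, 2}. pmf (tri_pmf p q) c *\<^sub>R measure_pmf.expectation (map_pmf (Pair c) L) f)"
    using assms set_tri_pmf[OF assms(1-3)] by (simp only:) (intro pmf_expectation_bind, auto)
  then show ?thesis
    using pmf_tri_pmf[OF assms(1-3)] by (simp add: E_def)
qed

lemma expectation_Pi_pmf_component:
  fixes f :: "'b \<Rightarrow> real"
  assumes "finite A" "u \<in> A"
  shows "measure_pmf.expectation (Pi_pmf A d p) (\<lambda>y. f (y u)) = measure_pmf.expectation (p u) f"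
proof -
  have "measure_pmf.expectation (Pi_pmf A d p) (\<lambda>y. f (y u))
      = measure_pmf.expectation (map_pmf (\<lambda>y. y u) (Pi_pmf A d p)) f" by simp
  also have "map_pmf (\<lambda>y. y u) (Pi_pmf A d p) = p u"
    using assms by (simp add: Pi_pmf_component)
  finally show ?thesis .
qed

lemma expectation_Pi_pmf_pair:
  fixes f g :: "'b \<Rightarrow> real"
  assumes A: "finite A" "u \<in> A" "v \<in> A" "u \<noteq> v" and fin: "\<And>x. x \<in> A \<Longrightarrow> finite (set_pmf (p x))"
    and nonneg: "\<And>y. f y \<ge> 0" "\<And>y. g y \<ge> 0"
  shows "measure_pmf.expectation (Pi_pmf A d p) (\<lambda>y. f (y u) * g (y v))
    = measure_pmf.expectation (p u) f * measure_pmf.expectation (p v) g"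
proof -
  define h where "h x = (if x = u then f else if x = v then g else (\<lambda>_. 1))" for x
  have pr: "(\<Prod>x\<in>A. F x) = F u * F v" if "\<And>x. x \<in> A \<Longrightarrow> x \<noteq> u \<Longrightarrow> x \<noteq> v \<Longrightarrow> F x = 1" for F :: "'a \<Rightarrow> real"
  proof -
    have "(\<Prod>x\<in>A. F x) = (\<Prod>x\<in>{u, v}. F x)"
      using A that by (intro prod.mono_neutral_right) auto
    then show ?thesis using A by simp
  qed
  have "measure_pmf.expectation (Pi_pmf A d p) (\<lambda>y. f (y u) * g (y v))
     = measure_pmf.expectation (Pi_pmf A d p) (\<lambda>y. \<Prod>x\<in>A. h x (y x))"
    using A by (subst pr) (auto simp: h_def)
  also have "\<dots> = (\<Prod>x\<in>A. measure_pmf.expectation (p x) (h x))"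
    using A fin nonneg by (intro expectation_prod_Pi_pmf integrable_measure_pmf_finite) (auto simp: h_def)
  also have "\<dots> = measure_pmf.expectation (p u) f * measure_pmf.expectation (p v) g"
    using A by (subst pr) (auto simp: h_def)
  finally show ?thesis .
qed

text \<open>The bilinear form of \<open>W\<close> without its diagonal. Only labels of distinct
  vertices are independent, so the diagonal enters expectations separately.\<close>

definition off_diag :: "nat \<Rightarrow> (nat \<Rightarrow> nat \<Rightarrow> real) \<Rightarrow> (nat \<Rightarrow> real) \<Rightarrow> (nat \<Rightarrow> real) \<Rightarrow> real" where
  "off_diag n W x y = (\<Sum>u<n. \<Sum>v\<in>{..<n} - {u}. W u v * x u * y v)"

lemma expectation_Pi_pmf_pair_sum:
  fixes f g :: "'b \<Rightarrow> real"
  assumes fin: "\<And>v. v < n \<Longrightarrow> finite (set_pmf (p v))" and finP: "finite (set_pmf (Pi_pmf {..<n} d p))"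
    and nonneg: "\<And>y. f y \<ge> 0" "\<And>y. g y \<ge> 0"
  shows "measure_pmf.expectation (Pi_pmf {..<n} d p) (\<lambda>\<omega>. \<Sum>u<n. \<Sum>v<n. W u v * f (\<omega> u) * g (\<omega> v))
    = (\<Sum>u<n. W u u * measure_pmf.expectation (p u) (\<lambda>y. f y * g y))
      + off_diag n W (\<lambda>v. measure_pmf.expectation (p v) f) (\<lambda>v. measure_pmf.expectation (p v) g)"
proof -
  note [simp] = integrable_measure_pmf_finite[OF finP]
  let ?P = "Pi_pmf {..<n} d p"
  have "measure_pmf.expectation ?P (\<lambda>\<omega>. \<Sum>u<n. \<Sum>v<n. W u v * f (\<omega> u) * g (\<omega> v))
      = (\<Sum>u<n. \<Sum>v<n. W u v * measure_pmf.expectation ?P (\<lambda>\<omega>. f (\<omega> u) * g (\<omega> v)))"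
    by (simp add: mult.assoc)
  also have "\<dots> = (\<Sum>u<n. W u u * measure_pmf.expectation ?P (\<lambda>\<omega>. f (\<omega> u) * g (\<omega> u))
      + (\<Sum>v\<in>{..<n} - {u}. W u v * measure_pmf.expectation ?P (\<lambda>\<omega>. f (\<omega> u) * g (\<omega> v))))"
    by (intro sum.cong refl sum.remove) auto
  also have "\<dots> = (\<Sum>u<n. W u u * measure_pmf.expectation (p u) (\<lambda>y. f y * g y)
      + (\<Sum>v\<in>{..<n} - {u}. W u v * measure_pmf.expectation (p u) f * measure_pmf.expectation (p v) g))"
  proof (intro sum.cong refl arg_cong2[where f = "(+)"])
    fix u v assume "u \<in> {..<n}" "v \<in> {..<n} - {u}"
    then show "W u v * measure_pmf.expectation ?P (\<lambda>\<omega>. f (\<omega> u) * g (\<omega> v))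
        = W u v * measure_pmf.expectation (p u) f * measure_pmf.expectation (p v) g"
      using fin nonneg by (subst expectation_Pi_pmf_pair) auto
  qed (simp add: expectation_Pi_pmf_component[where f = "\<lambda>y. f y * g y"])
  finally show ?thesis by (simp add: sum.distrib off_diag_def)
qed

text \<open>Label 0 is the randomly rounded near-optimal solution, label 1 a sparse random subset of the
  remaining vertices, label 2 everything else. With probability \<open>1 - p - q\<close> label 0 receives \<open>a\<close>;
  with probability \<open>p\<close> labels 1 and 2 receive \<open>b\<close>; with probability \<open>q\<close> label 1 receives \<open>a\<close> and
  label 2 receives \<open>b\<close>, except for the vertices in \<open>zeroed\<close>. All others receive 0. The relation
  \<open>R\<close> contains the edges, so that \<open>a\<close> and \<open>b\<close> never meet; it is everything for general weights
  and exactly the edge relation for weights at least \<open>\<delta>\<close>.\<close>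

definition zeroed :: "nat \<Rightarrow> (nat \<Rightarrow> nat \<Rightarrow> bool) \<Rightarrow> (nat \<Rightarrow> nat) \<Rightarrow> nat set" where
  "zeroed n R \<omega> = {v. v < n \<and> 1 < \<omega> v \<and> (\<exists>u<n. \<omega> u = 1 \<and> R u v)}"

text \<open>What remains for label 0 is \<open>1 - (1 - \<theta> v) = \<theta> v\<close>;
  \<open>f\<close> is the density of label 1 outside the core.\<close>

definition labels :: "nat \<Rightarrow> (nat \<Rightarrow> real) \<Rightarrow> real \<Rightarrow> (nat \<Rightarrow> nat) pmf" where
  "labels n \<theta> f = Pi_pmf {..<n} 2 (\<lambda>v. tri_pmf ((1 - \<theta> v) * f) ((1 - \<theta> v) * (1 - f)))"

locale random_labels =
  fixes n :: nat and W :: "nat \<Rightarrow> nat \<Rightarrow> real" and \<theta> :: "nat \<Rightarrow> real" and f :: real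
  assumes W: "weighted_graph n W"
    and \<theta>: "\<And>v. v < n \<Longrightarrow> 0 \<le> \<theta> v" "\<And>v. v < n \<Longrightarrow> \<theta> v \<le> 1"
    and f: "0 \<le> f" "f \<le> 1"
begin

definition x :: "nat \<Rightarrow> real" where "x v = 1 - \<theta> v"

definition E :: "((nat \<Rightarrow> nat) \<Rightarrow> real) \<Rightarrow> real" where
  "E = measure_pmf.expectation (labels n \<theta> f)"

lemma x: "v < n \<Longrightarrow> 0 \<le> x v" "v < n \<Longrightarrow> x v \<le> 1"
  using \<theta> by (auto simp: x_def)

lemma x_f: "v < n \<Longrightarrow> 0 \<le> x v * f" "v < n \<Longrightarrow> 0 \<le> x v * (1 - f)" 
    "v < n \<Longrightarrow> x v * f + x v * (1 - f) \<le> 1"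
  using x f by (auto simp: algebra_simps mult_left_le_one_le)

lemma labels_eq: "labels n \<theta> f = Pi_pmf {..<n} 2 (\<lambda>v. tri_pmf (x v * f) (x v * (1 - f)))"
  by (simp add: labels_def x_def)

lemma finite_labels: "finite (set_pmf (labels n \<theta> f))"
proof -
  have "finite (PiE_dflt {..<n} (2::nat) (\<lambda>v. set_pmf (tri_pmf (x v * f) (x v * (1 - f)))))"
    using set_tri_pmf[OF x_f] by (intro finite_PiE_dflt) (auto intro: finite_subset)
  then show ?thesis by (simp add: labels_eq set_Pi_pmf o_def)
qed

lemmas int = integrable_measure_pmf_finite[OF finite_labels]

lemma E_label:
  fixes c :: "nat \<Rightarrow> real"
  assumes "v < n"
  shows "E (\<lambda>\<omega>. c (\<omega> v)) = \<theta> v * c 0 + x v * f * c 1 + x v * (1 - f) * c 2"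
  unfolding E_def labels_eq using assms
  by (simp add: expectation_Pi_pmf_component expectation_tri_pmf[OF x_f]) (simp add: x_def algebra_simps)

lemma E_sum: "E (\<lambda>\<omega>. \<Sum>i\<in>I. g i \<omega>) = (\<Sum>i\<in>I. E (g i))"
  and E_add: "E (\<lambda>\<omega>. g1 \<omega> + g2 \<omega>) = E g1 + E g2"
  and E_diff: "E (\<lambda>\<omega>. g1 \<omega> - g2 \<omega>) = E g1 - E g2"
  and E_mult: "E (\<lambda>\<omega>. c * g1 \<omega>) = c * E g1"
  by (simp_all add: E_def int)

lemma E_mono:
  assumes "\<And>\<omega>. g1 \<omega> \<le> g2 \<omega>"
  shows "E g1 \<le> E g2"
  unfolding E_def using assms by (intro integral_mono) (auto simp: int)

lemma E_pair_sum:
  fixes c d :: "nat \<Rightarrow> real"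
  assumes "\<And>l. c l \<ge> 0" "\<And>l. d l \<ge> 0"
  shows "E (\<lambda>\<omega>. \<Sum>u<n. \<Sum>v<n. W u v * c (\<omega> u) * d (\<omega> v))
    = (\<Sum>u<n. \<theta> u * (c 0 * d 0) + x u * f * (c 1 * d 1) + x u * (1 - f) * (c 2 * d 2))
     + off_diag n W (\<lambda>u. \<theta> u * c 0 + x u * f * c 1 + x u * (1 - f) * c 2)
                    (\<lambda>u. \<theta> u * d 0 + x u * f * d 1 + x u * (1 - f) * d 2)"
proof -
  let ?p = "\<lambda>v. tri_pmf (x v * f) (x v * (1 - f))"
  have ex: "measure_pmf.expectation (?p v) h = \<theta> v * h 0 + x v * f * h 1 + x v * (1 - f) * h 2"
    if "v < n" for v and h :: "nat \<Rightarrow> real"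
    by (simp add: expectation_tri_pmf[OF x_f[OF that]]) (simp add: x_def algebra_simps)
  have "E (\<lambda>\<omega>. \<Sum>u<n. \<Sum>v<n. W u v * c (\<omega> u) * d (\<omega> v))
     = (\<Sum>u<n. W u u * measure_pmf.expectation (?p u) (\<lambda>y. c y * d y))
      + off_diag n W (\<lambda>v. measure_pmf.expectation (?p v) c) (\<lambda>v. measure_pmf.expectation (?p v) d)"
    unfolding E_def labels_eq
  proof (rule expectation_Pi_pmf_pair_sum)
    show "finite (set_pmf (?p v))" if "v < n" for v
      using set_tri_pmf[OF x_f[OF that]] by (rule finite_subset) auto
  qed (use assms finite_labels labels_eq in auto)
  also have "off_diag n W (\<lambda>v. measure_pmf.expectation (?p v) c) (\<lambda>v. measure_pmf.expectation (?p v) d)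
     = off_diag n W (\<lambda>u. \<theta> u * c 0 + x u * f * c 1 + x u * (1 - f) * c 2)
                    (\<lambda>u. \<theta> u * d 0 + x u * f * d 1 + x u * (1 - f) * d 2)"
    unfolding off_diag_def by (intro sum.cong refl) (simp add: ex)
  also have "(\<Sum>u<n. W u u * measure_pmf.expectation (?p u) (\<lambda>y. c y * d y))
     = (\<Sum>u<n. \<theta> u * (c 0 * d 0) + x u * f * (c 1 * d 1) + x u * (1 - f) * (c 2 * d 2))"
    using W by (intro sum.cong refl) (auto simp: ex weighted_graph_def)
  finally show ?thesis .
qed

end

section \<open>Off-diagonal weight, and expected sizes and weights of the label classes\<close>

lemma sum_Collect_less:
  fixes g :: "nat \<Rightarrow> real"
  shows "(\<Sum>v\<in>{v. v < n \<and> H v}. g v) = (\<Sum>v<n. of_bool (H v) * g v)"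
proof -
  have "{v. v < n \<and> H v} = {v \<in> {..<n}. H v}" by auto
  then show ?thesis by (simp only: sum.inter_filter finite_lessThan) (intro sum.cong, auto)
qed

lemma off_diag_nonneg:
  assumes "weighted_graph n W" "\<And>v. v < n \<Longrightarrow> 0 \<le> x v" "\<And>v. v < n \<Longrightarrow> 0 \<le> y v"
  shows "0 \<le> off_diag n W x y"
  unfolding off_diag_def using assms
  by (intro sum_nonneg mult_nonneg_nonneg) (auto simp: weighted_graph_def)

lemma off_diag_le:
  assumes "weighted_graph n W" "\<And>v. v < n \<Longrightarrow> 0 \<le> x v" "\<And>v. v < n \<Longrightarrow> 0 \<le> y v"
  shows "off_diag n W x y \<le> (\<Sum>v<n. x v) * (\<Sum>v<n. y v)"
proof -
  have "off_diag n W x y \<le> (\<Sum>u<n. \<Sum>v<n. x u * y v)"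
    unfolding off_diag_def
  proof (intro sum_mono)
    fix u assume u: "u \<in> {..<n}"
    have "(\<Sum>v\<in>{..<n} - {u}. W u v * x u * y v) \<le> (\<Sum>v\<in>{..<n} - {u}. 1 * x u * y v)"
      using assms u by (intro sum_mono mult_right_mono) (auto simp: weighted_graph_def)
    also have "\<dots> \<le> (\<Sum>v<n. x u * y v)"
      using assms u by (simp only: mult_1) (intro sum_mono2, auto)
    finally show "(\<Sum>v\<in>{..<n} - {u}. W u v * x u * y v) \<le> (\<Sum>v<n. x u * y v)" .
  qed
  then show ?thesis by (simp add: sum_product)
qed

lemma off_diag_commute:
  assumes "weighted_graph n W"
  shows "off_diag n W x y = off_diag n W y x"
proof -
  have eq: "off_diag n W x y = (\<Sum>u<n. \<Sum>v<n. if u = v then 0 else W u v * x u * y v)" for x y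
    unfolding off_diag_def by (intro sum.cong refl sum.mono_neutral_cong_left) auto
  show ?thesis
    unfolding eq[of x] eq[of y] using assms
    by (subst sum.swap) (intro sum.cong refl, auto simp: weighted_graph_def)
qed

lemma off_diag_scale: "off_diag n W (\<lambda>v. x v * c) (\<lambda>v. y v * d) = c * d * off_diag n W x y"
  unfolding off_diag_def by (simp add: sum_distrib_left mult_ac)

context random_labels
begin

text \<open>Expected number of vertices outside the core, expected size of the core, and expected
  total weight (diagonal included) outside the core. Thus \<open>G / N\<close> is an average
  weighted degree.\<close>

definition N :: real where "N = (\<Sum>v<n. x v)"
definition k :: real where "k = (\<Sum>v<n. \<theta> v)"
definition G :: real where "G = N + off_diag n W x x"

lemma N_le_G: "N \<le> G"
  using off_diag_nonneg[OF W x(1) x(1)] by (simp add: G_def)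

lemma N_nonneg: "0 \<le> N" and k_nonneg: "0 \<le> k"
  unfolding N_def k_def using x \<theta> by (auto intro!: sum_nonneg)

lemma N_eq: "N = n - k"
  by (simp add: N_def k_def x_def sum_subtractf)

text \<open>Feasibility at \<open>u\<close> says that the other vertices supply at least
  \<open>1 - \<theta> u = x u\<close>. Weighting by \<open>x u\<close> gives \<open>(x u)^2\<close>,
  which is at least \<open>1 - 2 * \<theta> u = x u - \<theta> u\<close>.\<close>

lemma off_diag_feasible:
  assumes "feasible n W \<theta>"
  shows "off_diag n W x \<theta> \<ge> N - k"
proof -
  have "N - k = (\<Sum>v<n. x v - \<theta> v)" by (simp add: N_def k_def sum_subtractf)
  also have "\<dots> \<le> (\<Sum>u<n. x u * (\<Sum>v\<in>{..<n} - {u}. W u v * \<theta> v))"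
  proof (intro sum_mono)
    fix u assume u: "u \<in> {..<n}"
    have "1 \<le> (\<Sum>v<n. W u v * \<theta> v)" using assms u by (auto simp: feasible_def)
    also have "\<dots> = \<theta> u + (\<Sum>v\<in>{..<n} - {u}. W u v * \<theta> v)"
      using u W by (subst sum.remove[of _ u]) (auto simp: weighted_graph_def)
    finally have "x u * x u \<le> x u * (\<Sum>v\<in>{..<n} - {u}. W u v * \<theta> v)"
      using x u by (intro mult_left_mono) (auto simp: x_def)
    moreover have "x u - \<theta> u \<le> x u * x u"
      using \<theta>[of u] u by (simp add: x_def algebra_simps)
    ultimately show "x u - \<theta> u \<le> x u * (\<Sum>v\<in>{..<n} - {u}. W u v * \<theta> v)" by linarith
  qed
  also have "\<dots> = off_diag n W x \<theta>"
    unfolding off_diag_def by (simp add: sum_distrib_left mult_ac)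
  finally show ?thesis .
qed

lemma E_zero: "E (\<lambda>_. 0) = 0"
  by (simp add: E_def)

lemma E_card:
  "E (\<lambda>\<omega>. card {v. v < n \<and> H (\<omega> v)})
    = of_bool (H 0) * k + (of_bool (H 1) * f + of_bool (H 2) * (1 - f)) * N"
proof -
  have "E (\<lambda>\<omega>. card {v. v < n \<and> H (\<omega> v)}) = E (\<lambda>\<omega>. \<Sum>v<n. of_bool (H (\<omega> v)))"
    using sum_Collect_less[where g = "\<lambda>_. 1"] by simp
  also have "\<dots> = (\<Sum>v<n. \<theta> v * of_bool (H 0) + x v * f * of_bool (H 1) + x v * (1 - f) * of_bool (H 2))"
    unfolding E_sum by (intro sum.cong refl E_label) auto
  finally show ?thesis
    unfolding sum.distrib sum_distrib_right[symmetric] k_def[symmetric] N_def[symmetric]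
    by (simp only: algebra_simps)
qed

lemma E_weight:
  "E (\<lambda>\<omega>. \<Sum>u\<in>{v. v < n \<and> H (\<omega> v)}. \<Sum>v\<in>{v. v < n \<and> H' (\<omega> v)}. W u v)
    = (\<Sum>u<n. \<theta> u * (of_bool (H 0) * of_bool (H' 0)) + x u * f * (of_bool (H 1) * of_bool (H' 1))
         + x u * (1 - f) * (of_bool (H 2) * of_bool (H' 2)))
     + off_diag n W (\<lambda>u. \<theta> u * of_bool (H 0) + x u * f * of_bool (H 1) + x u * (1 - f) * of_bool (H 2))
                    (\<lambda>u. \<theta> u * of_bool (H' 0) + x u * f * of_bool (H' 1) + x u * (1 - f) * of_bool (H' 2))"
proof -
  have "(\<Sum>u\<in>{v. v < n \<and> H (\<omega> v)}. \<Sum>v\<in>{v. v < n \<and> H' (\<omega> v)}. W u v)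
      = (\<Sum>u<n. \<Sum>v<n. W u v * of_bool (H (\<omega> u)) * of_bool (H' (\<omega> v)))" for \<omega>
    unfolding sum_Collect_less sum_distrib_left by (intro sum.cong refl) (simp only: mult_ac)
  then show ?thesis
    using E_pair_sum[of "\<lambda>l. of_bool (H l)" "\<lambda>l. of_bool (H' l)"] by simp
qed

lemma E_weights:
  shows E_weight_core: "E (\<lambda>\<omega>. \<Sum>u\<in>{v. v < n \<and> \<omega> v = 0}. \<Sum>v\<in>{v. v < n \<and> \<omega> v = 0}. W u v)
      = k + off_diag n W \<theta> \<theta>"
    and E_weight_rest: "E (\<lambda>\<omega>. \<Sum>u\<in>{v. v < n \<and> \<omega> v \<noteq> 0}. \<Sum>v\<in>{v. v < n \<and> \<omega> v \<noteq> 0}. W u v) = G"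
    and E_weight_sparse: "E (\<lambda>\<omega>. \<Sum>u\<in>{v. v < n \<and> \<omega> v = 1}. \<Sum>v\<in>{v. v < n \<and> \<omega> v = 1}. W u v)
      = f * N + f\<^sup>2 * (G - N)"
    and E_weight_rest_core: "E (\<lambda>\<omega>. \<Sum>u\<in>{v. v < n \<and> \<omega> v \<noteq> 0}. \<Sum>v\<in>{v. v < n \<and> \<omega> v = 0}. W u v)
      = off_diag n W x \<theta>"
    and E_weight_core_rest: "E (\<lambda>\<omega>. \<Sum>u\<in>{v. v < n \<and> \<omega> v = 0}. \<Sum>v\<in>{v. v < n \<and> \<omega> v \<noteq> 0}. W u v)
      = off_diag n W x \<theta>"
proof -
  have x_split: "x u * f + x u * (1 - f) = x u" for u by (simp add: algebra_simps)
  show "E (\<lambda>\<omega>. \<Sum>u\<in>{v. v < n \<and> \<omega> v = 0}. \<Sum>v\<in>{v. v < n \<and> \<omega> v = 0}. W u v)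
      = k + off_diag n W \<theta> \<theta>"
    using E_weight[where H = "\<lambda>l. l = 0" and H' = "\<lambda>l. l = 0"] by (simp add: k_def)
  show "E (\<lambda>\<omega>. \<Sum>u\<in>{v. v < n \<and> \<omega> v \<noteq> 0}. \<Sum>v\<in>{v. v < n \<and> \<omega> v \<noteq> 0}. W u v) = G"
    using E_weight[where H = "\<lambda>l. l \<noteq> 0" and H' = "\<lambda>l. l \<noteq> 0"] by (simp add: G_def N_def x_split)
  show "E (\<lambda>\<omega>. \<Sum>u\<in>{v. v < n \<and> \<omega> v = 1}. \<Sum>v\<in>{v. v < n \<and> \<omega> v = 1}. W u v)
      = f * N + f\<^sup>2 * (G - N)"
    using E_weight[where H = "\<lambda>l. l = 1" and H' = "\<lambda>l. l = 1"]
    by (simp add: G_def N_def off_diag_scale power2_eq_square mult.commute[of f "sum x {..<n}"] flip: sum_distrib_right)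
  show "E (\<lambda>\<omega>. \<Sum>u\<in>{v. v < n \<and> \<omega> v \<noteq> 0}. \<Sum>v\<in>{v. v < n \<and> \<omega> v = 0}. W u v) = off_diag n W x \<theta>"
    using E_weight[where H = "\<lambda>l. l \<noteq> 0" and H' = "\<lambda>l. l = 0"] by (simp add: x_split)
  show "E (\<lambda>\<omega>. \<Sum>u\<in>{v. v < n \<and> \<omega> v = 0}. \<Sum>v\<in>{v. v < n \<and> \<omega> v \<noteq> 0}. W u v) = off_diag n W x \<theta>"
    using E_weight[where H = "\<lambda>l. l = 0" and H' = "\<lambda>l. l \<noteq> 0"]
    by (subst off_diag_commute[OF W]) (simp add: x_split)
qed

text \<open>\<open>K\<close> is the expected number of recipients of \<open>a\<close> and
  \<open>M\<close> their mutual over-service per unit signal, so tightness forces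
  \<open>a = K / (K + M)\<close>. The hypothesis \<open>slack\<close> bounds the slack at signal 0
  from below, state by state, with \<open>b\<close> replaced by its lower bound
  \<open>N / (2 * G)\<close>.\<close>

lemma mixture_scheme:
  fixes p q Z :: real
  assumes pq: "0 \<le> q" "q \<le> p" "0 < p" "p + q \<le> 1" and N: "N > 0"
    and R: "\<And>u v. u < n \<Longrightarrow> v < n \<Longrightarrow> u \<noteq> v \<Longrightarrow> W u v > 0 \<Longrightarrow> R u v"
    and Z: "E (\<lambda>\<omega>. card (zeroed n R \<omega>)) \<le> Z"
    and K: "K = (1 - p - q) * k + q * f * N" "K > 0"
    and M: "M = (1 - p - q) * off_diag n W \<theta> \<theta> + q * f\<^sup>2 * (G - N)"
    and slack: "0 \<le> (1 - p - q) * (K / (K + M) * off_diag n W x \<theta> - N)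
        + p * (N / (2 * G) * off_diag n W x \<theta> - k) - q * (k + Z)"
  shows "\<exists>S \<phi>. card S = 3 \<and> signaling_scheme n S \<phi> \<and> persuasive n W S \<phi> \<and>
           cost n \<phi> \<le> K + 4 * p * N\<^sup>2 / G"
proof -
  \<comment> \<open>\<open>1 < \<omega> v\<close> instead of label 2: \<open>E_mono\<close> compares
    all functions \<omega>, so the classes must partition the vertices even for labels that have
    probability 0.\<close>
  define B3 where "B3 \<omega> = {v. v < n \<and> 1 < \<omega> v \<and> \<not> (\<exists>u<n. \<omega> u = 1 \<and> R u v)}" for \<omega> :: "nat \<Rightarrow> nat"
  define \<beta> where "\<beta> = E (\<lambda>\<omega>. card (B3 \<omega>))"
  define \<gamma> where "\<gamma> = E (\<lambda>\<omega>. \<Sum>u\<in>B3 \<omega>. \<Sum>v\<in>B3 \<omega>. W u v)"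
  define a where "a = K / (K + M)"
  define b where "b = (p * N + q * \<beta>) / (p * G + q * \<gamma>)"
  define A where "A = (\<lambda>(c :: nat, \<omega> :: nat \<Rightarrow> nat). if c = 0 then {v. v < n \<and> \<omega> v = 0}
      else if c = 2 then {v. v < n \<and> \<omega> v = 1} else {})"
  define B where "B = (\<lambda>(c :: nat, \<omega> :: nat \<Rightarrow> nat). if c = 1 then {v. v < n \<and> \<omega> v \<noteq> 0}
      else if c = 2 then B3 \<omega> else {})"
  let ?P = "pair_pmf (tri_pmf p q) (labels n \<theta> f)"
  have W0: "0 \<le> W u v" if "u < n" "v < n" for u v using W that by (auto simp: weighted_graph_def)
  have finB3: "finite (B3 \<omega>)" for \<omega> by (simp add: B3_def)
  have p0: "0 \<le> p" using pq by simp
  note E_pair = expectation_pair_tri_pmf[OF p0 pq(1,4) finite_labels, folded E_def]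
  have G: "G > 0" "N \<le> G" using N N_le_G by auto
  have \<beta>0: "0 \<le> \<beta>" using E_mono[of "\<lambda>_. 0" "\<lambda>\<omega>. card (B3 \<omega>)"] by (simp add: \<beta>_def E_def)
  have E_rest: "E (\<lambda>\<omega>. card {v. v < n \<and> \<omega> v \<noteq> 0}) = N"
    using E_card[of "\<lambda>l. l \<noteq> 0"] by simp
  have "\<beta> \<le> E (\<lambda>\<omega>. card {v. v < n \<and> \<omega> v \<noteq> 0})"
    unfolding \<beta>_def by (intro E_mono of_nat_mono card_mono) (auto simp: B3_def)
  then have \<beta>N: "\<beta> \<le> N" unfolding E_rest .
  have "\<beta> \<le> \<gamma>"
    unfolding \<beta>_def \<gamma>_def
  proof (intro E_mono)
    fix \<omega>
    have "(\<Sum>u\<in>B3 \<omega>. 1) \<le> (\<Sum>u\<in>B3 \<omega>. \<Sum>v\<in>B3 \<omega>. W u v)"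
    proof (intro sum_mono)
      fix u assume u: "u \<in> B3 \<omega>"
      then have "W u u \<le> (\<Sum>v\<in>B3 \<omega>. W u v)"
        using finB3 W0 by (intro member_le_sum) (auto simp: B3_def)
      then show "1 \<le> (\<Sum>v\<in>B3 \<omega>. W u v)" using W u by (auto simp: weighted_graph_def B3_def)
    qed
    then show "card (B3 \<omega>) \<le> (\<Sum>u\<in>B3 \<omega>. \<Sum>v\<in>B3 \<omega>. W u v)" by simp
  qed
  have "\<gamma> \<le> E (\<lambda>\<omega>. \<Sum>u\<in>{v. v < n \<and> \<omega> v \<noteq> 0}. \<Sum>v\<in>{v. v < n \<and> \<omega> v \<noteq> 0}. W u v)"
    unfolding \<gamma>_def
  proof (intro E_mono)
    fix \<omega> :: "nat \<Rightarrow> nat"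
    let ?O = "{v. v < n \<and> \<omega> v \<noteq> 0}"
    have sub: "B3 \<omega> \<subseteq> ?O" by (auto simp: B3_def)
    have "(\<Sum>u\<in>B3 \<omega>. \<Sum>v\<in>B3 \<omega>. W u v) \<le> (\<Sum>u\<in>B3 \<omega>. \<Sum>v\<in>?O. W u v)"
      using sub W0 by (intro sum_mono sum_mono2) auto
    also have "\<dots> \<le> (\<Sum>u\<in>?O. \<Sum>v\<in>?O. W u v)"
      using sub W0 by (intro sum_mono2) (auto intro!: sum_nonneg)
    finally show "(\<Sum>u\<in>B3 \<omega>. \<Sum>v\<in>B3 \<omega>. W u v) \<le> (\<Sum>u\<in>?O. \<Sum>v\<in>?O. W u v)" .
  qed
  then have \<gamma>G: "\<gamma> \<le> G" unfolding E_weight_rest .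
  have \<gamma>0: "0 \<le> \<gamma>" using \<beta>0 \<open>\<beta> \<le> \<gamma>\<close> by simp
  have M0: "M \<ge> 0" unfolding M
    using pq G off_diag_nonneg[OF W \<theta>(1) \<theta>(1)] by (intro add_nonneg_nonneg mult_nonneg_nonneg) auto
  have a: "0 < a" "a \<le> 1" using K M0 by (auto simp: a_def)
  have pos_num: "p * N + q * \<beta> > 0" "p * G + q * \<gamma> > 0"
    using pq N G \<beta>0 \<gamma>0 by (auto intro!: add_pos_nonneg)
  have b: "0 < b" "b \<le> 1"
    using pos_num G \<open>\<beta> \<le> \<gamma>\<close> pq by (auto simp: b_def intro!: add_mono mult_left_mono)
  \<comment> \<open>As \<open>q \<le> p\<close>, the third state adds at most as much to the
    numerator and the denominator of \<open>b\<close> as the second, so \<open>b\<close> is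
    \<open>N / G\<close> up to a factor 2.\<close>
  have qb: "q * \<beta> \<le> p * N" "q * \<gamma> \<le> p * G" using pq \<beta>0 \<beta>N \<gamma>0 \<gamma>G by (auto intro!: mult_mono)
  have b_ge: "N / (2 * G) \<le> b"
  proof -
    have "N / (2 * G) = (p * N) / (2 * (p * G))" using pq by simp
    also have "\<dots> \<le> b" unfolding b_def using qb pos_num pq N G \<beta>0 by (intro frac_le) auto
    finally show ?thesis .
  qed
  have b_le: "b \<le> 2 * N / G"
  proof -
    have "b \<le> (2 * (p * N)) / (p * G)"
      unfolding b_def using qb pos_num pq N G \<gamma>0 by (intro frac_le) auto
    also have "\<dots> = 2 * N / G" using pq by simp
    finally show ?thesis .
  qed
  have EcA: "measure_pmf.expectation ?P (\<lambda>\<omega>. card (A \<omega>)) = K"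
    unfolding E_pair using E_card[of "\<lambda>l. l = 0"] E_card[of "\<lambda>l. l = 1"]
    by (simp add: A_def K E_zero)
  have EcB: "measure_pmf.expectation ?P (\<lambda>\<omega>. card (B \<omega>)) = p * N + q * \<beta>"
    unfolding E_pair using E_rest by (simp add: B_def \<beta>_def E_zero)
  have EwA: "measure_pmf.expectation ?P (\<lambda>\<omega>. \<Sum>u\<in>A \<omega>. \<Sum>v\<in>A \<omega>. W u v) = K + M"
    unfolding E_pair using E_weight_core E_weight_sparse
    by (simp add: A_def E_zero K M) (simp add: algebra_simps)
  have EwB: "measure_pmf.expectation ?P (\<lambda>\<omega>. \<Sum>u\<in>B \<omega>. \<Sum>v\<in>B \<omega>. W u v) = p * G + q * \<gamma>"
    unfolding E_pair using E_weight_rest by (simp add: B_def \<gamma>_def E_zero)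
  define sl where "sl \<omega> = (\<Sum>v\<in>{..<n} - A \<omega> - B \<omega>.
      a * (\<Sum>u\<in>A \<omega>. W v u) + b * (\<Sum>u\<in>B \<omega>. W v u) - 1)" for \<omega>
  have sl0: "E (\<lambda>\<omega>. sl (0, \<omega>)) = a * off_diag n W x \<theta> - N"
  proof -
    have "{..<n} - {v. v < n \<and> \<omega> v = 0} = {v. v < n \<and> \<omega> v \<noteq> 0}" for \<omega> :: "nat \<Rightarrow> nat" by auto
    then have "E (\<lambda>\<omega>. sl (0, \<omega>)) = E (\<lambda>\<omega>. a * (\<Sum>u\<in>{v. v < n \<and> \<omega> v \<noteq> 0}. \<Sum>v\<in>{v. v < n \<and> \<omega> v = 0}. W u v)
        - card {v. v < n \<and> \<omega> v \<noteq> 0})"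
      by (simp add: sl_def A_def B_def sum_subtractf sum_distrib_left)
    then show ?thesis by (simp only: E_diff E_mult E_weight_rest_core E_rest)
  qed
  have sl1: "E (\<lambda>\<omega>. sl (1, \<omega>)) = b * off_diag n W x \<theta> - k"
  proof -
    have "{..<n} - {v. v < n \<and> \<omega> v \<noteq> 0} = {v. v < n \<and> \<omega> v = 0}" for \<omega> :: "nat \<Rightarrow> nat" by auto
    then have "E (\<lambda>\<omega>. sl (1, \<omega>)) = E (\<lambda>\<omega>. b * (\<Sum>u\<in>{v. v < n \<and> \<omega> v = 0}. \<Sum>v\<in>{v. v < n \<and> \<omega> v \<noteq> 0}. W u v)
        - card {v. v < n \<and> \<omega> v = 0})"
      by (simp add: sl_def A_def B_def sum_subtractf sum_distrib_left)
    then show ?thesis using E_card[of "\<lambda>l. l = 0"] by (simp only: E_diff E_mult E_weight_core_rest) simp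
  qed
  \<comment> \<open>In the third state all service is discarded and each vertex with signal 0 is
    charged a full unit.\<close>
  have sl2: "E (\<lambda>\<omega>. sl (2, \<omega>)) \<ge> - (k + Z)"
  proof -
    have "- (real (card {v. v < n \<and> \<omega> v = 0}) + card (zeroed n R \<omega>)) \<le> sl (2, \<omega>)" for \<omega>
    proof -
      have eq: "{..<n} - A (2, \<omega>) - B (2, \<omega>) = {v. v < n \<and> \<omega> v = 0} \<union> zeroed n R \<omega>"
        by (auto simp: A_def B_def B3_def zeroed_def intro: Suc_lessI)
      have "card ({v. v < n \<and> \<omega> v = 0} \<union> zeroed n R \<omega>) \<le> card {v. v < n \<and> \<omega> v = 0} + card (zeroed n R \<omega>)"
        by (rule card_Un_le)
      then have "- (real (card {v. v < n \<and> \<omega> v = 0}) + card (zeroed n R \<omega>))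
          \<le> - real (card ({..<n} - A (2, \<omega>) - B (2, \<omega>)))" unfolding eq by linarith
      also have "\<dots> = (\<Sum>v\<in>{..<n} - A (2, \<omega>) - B (2, \<omega>). - 1)" by simp
      also have "\<dots> \<le> sl (2, \<omega>)"
        unfolding sl_def
      proof (intro sum_mono)
        fix v assume v: "v \<in> {..<n} - A (2, \<omega>) - B (2, \<omega>)"
        have "0 \<le> a * (\<Sum>u\<in>A (2, \<omega>). W v u)" "0 \<le> b * (\<Sum>u\<in>B (2, \<omega>). W v u)"
          using v a b W0 by (auto intro!: mult_nonneg_nonneg sum_nonneg simp: A_def B_def B3_def)
        then show "- 1 \<le> a * (\<Sum>u\<in>A (2, \<omega>). W v u) + b * (\<Sum>u\<in>B (2, \<omega>). W v u) - 1" by linarith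
      qed
      finally show ?thesis .
    qed
    then have "E (\<lambda>\<omega>. - 1 * (real (card {v. v < n \<and> \<omega> v = 0}) + card (zeroed n R \<omega>))) \<le> E (\<lambda>\<omega>. sl (2, \<omega>))"
      by (intro E_mono) simp
    then show ?thesis unfolding E_mult E_add using E_card[of "\<lambda>l. l = 0"] Z by simp
  qed
  have "0 \<le> (1 - p - q) * (a * off_diag n W x \<theta> - N)
        + p * (N / (2 * G) * off_diag n W x \<theta> - k) - q * (k + Z)" using slack by (simp add: a_def)
  also have "\<dots> \<le> (1 - p - q) * E (\<lambda>\<omega>. sl (0, \<omega>)) + p * E (\<lambda>\<omega>. sl (1, \<omega>)) + q * E (\<lambda>\<omega>. sl (2, \<omega>))"
  proof -
    have "N / (2 * G) * off_diag n W x \<theta> \<le> b * off_diag n W x \<theta>"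
      using b_ge off_diag_nonneg[OF W x(1) \<theta>(1)] by (intro mult_right_mono) auto
    then have "p * (N / (2 * G) * off_diag n W x \<theta> - k) \<le> p * E (\<lambda>\<omega>. sl (1, \<omega>))"
      unfolding sl1 using p0 by (intro mult_left_mono) auto
    moreover have "q * - (k + Z) \<le> q * E (\<lambda>\<omega>. sl (2, \<omega>))" using sl2 pq(1) by (rule mult_left_mono)
    moreover have "q * - (k + Z) = - (q * (k + Z))" by (rule mult_minus_right)
    ultimately show ?thesis unfolding sl0 by linarith
  qed
  also have "\<dots> = measure_pmf.expectation ?P sl" unfolding E_pair ..
  finally have zero: "0 \<le> measure_pmf.expectation ?P sl" .
  have "finite (set_pmf ?P)"
    using set_tri_pmf[OF p0 pq(1,4)] finite_labels by (auto intro: finite_subset)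
  moreover have "A \<omega> \<subseteq> {..<n}" "B \<omega> \<subseteq> {..<n}" "A \<omega> \<inter> B \<omega> = {}" for \<omega>
    by (auto simp: A_def B_def B3_def split: prod.splits if_splits)
  moreover have "W u v = 0" if "u \<in> A \<omega>" "v \<in> B \<omega>" for \<omega> u v
  proof -
    obtain c l where \<omega>: "\<omega> = (c, l)" by (cases \<omega>)
    then have uv: "u < n" "v < n" "l u = 1" "1 < l v" "\<not> R u v"
      using that by (auto simp: A_def B_def B3_def split: if_splits)
    then have "u \<noteq> v" by auto
    then show ?thesis using R[of u v] uv W0[of u v] by fastforce
  qed
  moreover have "a * measure_pmf.expectation ?P (\<lambda>\<omega>. \<Sum>u\<in>A \<omega>. \<Sum>v\<in>A \<omega>. W u v)
      = measure_pmf.expectation ?P (\<lambda>\<omega>. card (A \<omega>))"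
    unfolding EwA EcA a_def using K M0 by simp
  moreover have "b * measure_pmf.expectation ?P (\<lambda>\<omega>. \<Sum>u\<in>B \<omega>. \<Sum>v\<in>B \<omega>. W u v)
      = measure_pmf.expectation ?P (\<lambda>\<omega>. card (B \<omega>))"
    unfolding EwB EcB b_def using pos_num by simp
  ultimately have "\<exists>S \<phi>. card S = 3 \<and> signaling_scheme n S \<phi> \<and> persuasive n W S \<phi> \<and>
      cost n \<phi> = a * measure_pmf.expectation ?P (\<lambda>\<omega>. card (A \<omega>)) 
        + b * measure_pmf.expectation ?P (\<lambda>\<omega>. card (B \<omega>))"
    using a b zero by (intro scheme_of_random_sets[OF W]) (simp_all only: sl_def[abs_def])
  moreover have "a * K + b * (p * N + q * \<beta>) \<le> K + 4 * p * N\<^sup>2 / G"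
  proof -
    have "a * K \<le> K" using a K by simp
    moreover have "b * (p * N + q * \<beta>) \<le> (2 * N / G) * (2 * (p * N))"
      using b_le qb b pos_num N G by (intro mult_mono) auto
    moreover have "(2 * N / G) * (2 * (p * N)) = 4 * p * N\<^sup>2 / G" by (simp add: power2_eq_square)
    ultimately show ?thesis by linarith
  qed
  ultimately show ?thesis unfolding EcA EcB by metis
qed

end

section \<open>Upper bounds\<close>

context random_labels
begin

text \<open>The budget: since \<open>b\<close> is about \<open>1 / D\<close>, the second state with
  \<open>p = X * D / (2 * n)\<close> costs at most \<open>2 * X\<close> and supplies slack at least
  \<open>X / 8 - k\<close>. The first state loses at most \<open>X / 32 + k\<close>, the third
  \<open>X / 64 + k\<close>; \<open>192 * k \<le> X\<close> absorbs the three
  \<open>k\<close>.\<close>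

lemma mixture_scheme_cost:
  fixes X q Z D :: real
  assumes feas: "feasible n W \<theta>" and X: "0 < X" "X \<le> n" "192 * k \<le> X"
    and D: "D = G / N" "X * D \<le> n"
    and q: "0 < q" "q \<le> X * D / (2 * n)" and f0: "0 < f"
    and R: "\<And>u v. u < n \<Longrightarrow> v < n \<Longrightarrow> u \<noteq> v \<Longrightarrow> W u v > 0 \<Longrightarrow> R u v"
    and Z: "E (\<lambda>\<omega>. card (zeroed n R \<omega>)) \<le> Z"
    and fDn: "f * D * n \<le> X / 64" and kqf: "k\<^sup>2 \<le> X / 64 * (q * f)"
    and qZ: "q * Z \<le> X / 64" and qfn: "q * f * n \<le> X"
  shows "\<exists>S \<phi>. card S = 3 \<and> signaling_scheme n S \<phi> \<and> persuasive n W S \<phi> \<and> cost n \<phi> \<le> 4 * X"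
proof -
  define p where "p = X * D / (2 * n)"
  define K where "K = (1 - p - q) * k + q * f * N"
  define M where "M = (1 - p - q) * off_diag n W \<theta> \<theta> + q * f\<^sup>2 * (G - N)"
  define Y where "Y = off_diag n W x \<theta>"
  define a where "a = K / (K + M)"
  have n: "real n > 0" using X by simp
  have k: "0 \<le> k" "192 * k \<le> n" using k_nonneg X by auto
  have N: "N > 0" "N \<le> n" "n / 2 \<le> N - k" using k n by (auto simp: N_eq)
  have G: "G > 0" "N \<le> G" "G = D * N" using N(1) N_le_G by (auto simp: D(1))
  have D1: "D \<ge> 1" using G(2) N(1) by (simp add: D(1))
  have p: "0 < p" "p \<le> 1 / 2" using X n D1 D(2) by (auto simp: p_def field_simps)
  have qp: "q \<le> p" using q by (simp add: p_def)
  have pq: "p + q \<le> 1" "0 \<le> 1 - p - q" "1 - p - q \<le> 1" using p q qp by auto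
  have qfN: "q * f * N > 0" using q f0 N by simp
  have K: "K \<ge> q * f * N" "K > 0" unfolding K_def using pq k qfN by (auto intro: add_nonneg_pos)
  have T: "0 \<le> off_diag n W \<theta> \<theta>" "off_diag n W \<theta> \<theta> \<le> k\<^sup>2"
    using off_diag_nonneg[OF W \<theta>(1) \<theta>(1)] off_diag_le[OF W \<theta>(1) \<theta>(1)]
    by (auto simp: k_def power2_eq_square)
  have M0: "M \<ge> 0" unfolding M_def using pq q G T by simp
  have M_le: "M \<le> k\<^sup>2 + q * f\<^sup>2 * G"
  proof -
    have "(1 - p - q) * off_diag n W \<theta> \<theta> \<le> 1 * k\<^sup>2" using pq T by (intro mult_mono) auto
    moreover have "q * f\<^sup>2 * (G - N) \<le> q * f\<^sup>2 * G" using q N by (intro mult_left_mono) auto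
    ultimately show ?thesis by (simp add: M_def)
  qed
  have a: "0 \<le> a" "a \<le> 1" using K M0 by (auto simp: a_def)
  \<comment> \<open>Keeping only the sparse share \<open>q * f * N\<close> of \<open>K\<close> in
    the denominator is the dilution; \<open>fDn\<close> and \<open>kqf\<close> are what its two
    error terms need.\<close>
  have eps: "(1 - a) * N \<le> X / 32"
  proof -
    have "1 - a = M / (K + M)" using K M0 by (simp add: a_def field_simps)
    also have "\<dots> \<le> (k\<^sup>2 + q * f\<^sup>2 * G) / (q * f * N)" using K M0 M_le qfN by (intro frac_le) auto
    finally have "(1 - a) * N \<le> (k\<^sup>2 + q * f\<^sup>2 * G) / (q * f * N) * N"
      using N by (intro mult_right_mono) auto
    also have "\<dots> = k\<^sup>2 / (q * f) + f * G"
      using q f0 N by (simp add: field_simps power2_eq_square)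
    also have "k\<^sup>2 / (q * f) \<le> X / 64" using kqf q f0 by (simp add: pos_divide_le_eq)
    also have "f * G \<le> f * D * n" using N f0 D1 by (simp add: G(3))
    finally show ?thesis using fDn by simp
  qed
  have Y: "Y \<ge> N - k" unfolding Y_def by (rule off_diag_feasible[OF feas])
  have "(1 - p - q) * (a * Y - N) \<ge> - (X / 32 + k)"
  proof -
    have "a * (N - k) \<le> a * Y" using Y a by (intro mult_left_mono) auto
    moreover have "a * k \<le> k" using a k by (simp add: mult_left_le_one_le)
    ultimately have *: "- (X / 32 + k) \<le> a * Y - N" using eps by (simp add: algebra_simps)
    show ?thesis
    proof (cases "a * Y - N \<ge> 0")
      case True
      then have "0 \<le> (1 - p - q) * (a * Y - N)" using pq by simp
      then show ?thesis using X k by simp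
    next
      case False
      then have "1 * (a * Y - N) \<le> (1 - p - q) * (a * Y - N)"
        using pq by (intro mult_right_mono_neg) auto
      then show ?thesis using * by simp
    qed
  qed
  moreover have "p * (N / (2 * G) * Y - k) \<ge> X / 8 - k"
  proof -
    have "p * (N / (2 * G) * (n / 2)) \<le> p * (N / (2 * G) * Y)"
      using p N G Y by (intro mult_left_mono) auto
    moreover have "p * (N / (2 * G) * (n / 2)) = X / 8"
      using n N G D1 by (simp add: p_def G(3))
    moreover have "p * k \<le> k" using p k by (simp add: mult_left_le_one_le)
    ultimately show ?thesis unfolding right_diff_distrib by linarith
  qed
  moreover have "q * (k + Z) \<le> k + X / 64"
  proof -
    have "q * k \<le> k" using q qp p k by (simp add: mult_left_le_one_le)
    then show ?thesis using qZ by (simp add: distrib_left)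
  qed
  ultimately have "0 \<le> (1 - p - q) * (K / (K + M) * Y - N) + p * (N / (2 * G) * Y - k) - q * (k + Z)"
    using X unfolding a_def by linarith
  then have "\<exists>S \<phi>. card S = 3 \<and> signaling_scheme n S \<phi> \<and> persuasive n W S \<phi> \<and>
           cost n \<phi> \<le> K + 4 * p * N\<^sup>2 / G"
    using q qp p pq N R Z K unfolding Y_def
    by (intro mixture_scheme[where R = R and Z = Z and q = q and M = M]) (auto simp: K_def M_def)
  moreover have "K + 4 * p * N\<^sup>2 / G \<le> 4 * X"
  proof -
    have "(1 - p - q) * k \<le> k" using pq k by (simp add: mult_left_le_one_le)
    moreover have "q * f * N \<le> q * f * n" using q f0 N by simp
    moreover have "4 * p * N\<^sup>2 / G = 2 * X * (N / n)"
      using N n D1 by (simp add: p_def G(3) power2_eq_square field_simps)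
    moreover have "2 * X * (N / n) \<le> 2 * X" using X N n by (simp add: field_simps)
    ultimately show ?thesis using qfn X k unfolding K_def by linarith
  qed
  ultimately show ?thesis by (meson order_trans)
qed

lemma G_le_total: "G \<le> (\<Sum>u<n. \<Sum>v<n. W u v)"
proof -
  have "G = (\<Sum>u<n. x u + (\<Sum>v\<in>{..<n} - {u}. W u v * x u * x v))"
    by (simp add: G_def N_def off_diag_def sum.distrib)
  also have "\<dots> \<le> (\<Sum>u<n. \<Sum>v<n. W u v)"
  proof (intro sum_mono)
    fix u assume u: "u \<in> {..<n}"
    have "(\<Sum>v\<in>{..<n} - {u}. W u v * x u * x v) \<le> (\<Sum>v\<in>{..<n} - {u}. W u v * 1 * 1)"
      using x u W by (intro sum_mono mult_mono) (auto simp: weighted_graph_def intro!: mult_left_le)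
    moreover have "x u \<le> W u u" using x u W by (auto simp: weighted_graph_def)
    moreover have "(\<Sum>v<n. W u v) = W u u + (\<Sum>v\<in>{..<n} - {u}. W u v)"
      using u by (intro sum.remove) auto
    ultimately show "x u + (\<Sum>v\<in>{..<n} - {u}. W u v * x u * x v) \<le> (\<Sum>v<n. W u v)" by simp
  qed
  finally show ?thesis .
qed

text \<open>A constant signal never costs more than \<open>n\<close>. If
  \<open>X * (G / N) > n\<close> while \<open>X \<le> n\<close>, the total weight is at least
  \<open>n^2 / (2 * X)\<close>, and it costs at most \<open>2 * X\<close>.\<close>

lemma dense_scheme:
  assumes X: "0 < X" "192 * k \<le> X" and dense: "X > n \<or> X * (G / N) > n" and n: "n > 0"
  shows "\<exists>S \<phi>. card S = 3 \<and> signaling_scheme n S \<phi> \<and> persuasive n W S \<phi> \<and> cost n \<phi> \<le> 4 * X"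
proof -
  let ?w = "\<Sum>u<n. \<Sum>v<n. W u v"
  have w: "?w \<ge> n" by (rule constant_signal_scheme(2)[OF W n])
  have "(real n)\<^sup>2 / ?w \<le> 4 * X"
  proof (cases "X > n")
    case True
    have "(real n)\<^sup>2 / ?w \<le> (real n)\<^sup>2 / n" using w n by (intro divide_left_mono) auto
    also have "\<dots> = n" by (simp add: power2_eq_square)
    finally show ?thesis using True X by simp
  next
    case False
    then have N: "N \<ge> n / 2" "N > 0" using X n by (auto simp: N_eq)
    then have "n * N < X * G" using dense False by (simp add: field_simps)
    also have "\<dots> \<le> X * ?w" using G_le_total X by simp
    finally have "n * N \<le> X * ?w" by simp
    moreover have "n * (n / 2) \<le> n * N" using N by (intro mult_left_mono) auto
    ultimately have "n * (n / 2) \<le> X * ?w" by linarith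
    then have "(real n)\<^sup>2 / ?w \<le> 2 * X" using w n by (simp add: field_simps power2_eq_square)
    then show ?thesis using X by simp
  qed
  then show ?thesis using constant_signal_scheme(1)[OF W n] by (metis (no_types, lifting))
qed

text \<open>Each zeroed vertex is joined to label 1 by weight at least \<delta>, so their number is
  at most \<open>1 / \<delta>\<close> times the weight between the labels 1 and 2.\<close>

lemma expected_zeroed:
  assumes \<delta>: "0 < \<delta>" and ge: "edge_weights_ge n W \<delta>"
  shows "E (\<lambda>\<omega>. card (zeroed n (\<lambda>u v. W u v > 0) \<omega>)) \<le> f * G / \<delta>"
proof -
  have W0: "0 \<le> W u v" if "u < n" "v < n" for u v using W that by (auto simp: weighted_graph_def)
  have "E (\<lambda>\<omega>. card (zeroed n (\<lambda>u v. W u v > 0) \<omega>))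
    \<le> E (\<lambda>\<omega>. 1 / \<delta> * (\<Sum>u\<in>{v. v < n \<and> \<omega> v = 1}. \<Sum>v\<in>{v. v < n \<and> 1 < \<omega> v}. W u v))"
  proof (rule E_mono)
    fix \<omega> :: "nat \<Rightarrow> nat"
    let ?U = "{v. v < n \<and> \<omega> v = 1}" and ?V = "{v. v < n \<and> 1 < \<omega> v}"
    let ?Z = "zeroed n (\<lambda>u v. W u v > 0) \<omega>"
    have "(\<Sum>v\<in>?Z. \<delta>) \<le> (\<Sum>v\<in>?Z. \<Sum>u\<in>?U. W u v)"
    proof (intro sum_mono)
      fix v assume "v \<in> ?Z"
      then obtain u where u: "u < n" "\<omega> u = 1" "W u v > 0" "v < n" "1 < \<omega> v" by (auto simp: zeroed_def)
      then have "u \<noteq> v" by auto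
      then have "\<delta> \<le> W u v" using ge u by (auto simp: edge_weights_ge_def)
      also have "\<dots> \<le> (\<Sum>u\<in>?U. W u v)" using u W0 by (intro member_le_sum) auto
      finally show "\<delta> \<le> (\<Sum>u\<in>?U. W u v)" .
    qed
    also have "\<dots> \<le> (\<Sum>v\<in>?V. \<Sum>u\<in>?U. W u v)"
      using W0 by (intro sum_mono2) (auto simp: zeroed_def intro!: sum_nonneg)
    also have "\<dots> = (\<Sum>u\<in>?U. \<Sum>v\<in>?V. W u v)" by (rule sum.swap)
    finally show "card ?Z \<le> 1 / \<delta> * (\<Sum>u\<in>?U. \<Sum>v\<in>?V. W u v)"
      using \<delta> by (simp add: field_simps)
  qed
  also have "\<dots> = 1 / \<delta> * (f * (1 - f) * off_diag n W x x)"
    unfolding E_mult using E_weight[where H = "\<lambda>l. l = 1" and H' = "\<lambda>l. 1 < l"]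
    by (simp add: off_diag_scale)
  also have "\<dots> \<le> 1 / \<delta> * (f * 1 * G)"
  proof -
    have o: "0 \<le> off_diag n W x x" "off_diag n W x x \<le> G"
      using off_diag_nonneg[OF W x(1) x(1)] N_nonneg by (auto simp: G_def)
    show ?thesis using \<delta> f o by (intro mult_left_mono mult_mono) auto
  qed
  finally show ?thesis by simp
qed

end

text \<open>With tiny weights a single label-1 vertex may be adjacent to everything, so
  \<open>R\<close> is total and only \<open>Z = n\<close> is available. This caps \<open>q\<close>
  at \<open>X / (64 * n)\<close>, while the weight inside the sparse set caps
  \<open>f\<close>.\<close>

lemma scheme_general:
  assumes W: "weighted_graph n W" and n: "n > 0"
    and \<theta>: "\<And>v. v < n \<Longrightarrow> 0 \<le> \<theta> v" "\<And>v. v < n \<Longrightarrow> \<theta> v \<le> 1" and feas: "feasible n W \<theta>"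
    and X: "0 < X" "192 * (\<Sum>v<n. \<theta> v) \<le> X" "64 ^ 3 * (\<Sum>v<n. \<theta> v)\<^sup>2 * real n ^ 3 \<le> X ^ 4"
  shows "\<exists>S \<phi>. card S = 3 \<and> signaling_scheme n S \<phi> \<and> persuasive n W S \<phi> \<and> cost n \<phi> \<le> 4 * X"
proof -
  define D where "D = random_labels.G n W \<theta> / random_labels.N n \<theta>"
  \<comment> \<open>\<open>G\<close>, \<open>N\<close> and \<open>k\<close> do not depend on the
    density \<open>f\<close>, which is chosen from \<open>D\<close> only later; any density serves
    to access their facts.\<close>
  have loc: "random_labels n W \<theta> 0" using W \<theta> by unfold_locales auto
  show ?thesis
  proof (cases "X > n \<or> X * D > n")
    case True
    then show ?thesis
      using random_labels.dense_scheme[OF loc] X n by (simp add: D_def random_labels.k_def[OF loc])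
  next
    case False
    have "random_labels.N n \<theta> > 0"
      using X False n by (simp add: random_labels.N_eq[OF loc] random_labels.k_def[OF loc])
    then have D: "D \<ge> 1" using random_labels.N_le_G[OF loc] by (simp add: D_def)
    define f where "f = X / (64 * n * D)"
    define q where "q = X / (64 * n)"
    have f01: "0 < f" "f \<le> 1"
    proof -
      show "0 < f" using X n D by (simp add: f_def)
      have "X * 1 \<le> n * D" using False D n X by (intro mult_mono) auto
      then have "X / (n * D) \<le> 1" using n D by simp
      then have "1 / 64 * (X / (n * D)) \<le> 1 / 64 * 1" by (rule mult_left_mono) simp
      also have "1 / 64 * (X / (n * D)) = f" by (simp add: f_def)
      finally show "f \<le> 1" by simp
    qed
    interpret random_labels n W \<theta> f using W \<theta> f01 by unfold_locales auto
    have XD: "X \<le> n" "X * D \<le> n" using False by auto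
    have "E (\<lambda>\<omega>. card (zeroed n (\<lambda>_ _. True) \<omega>)) \<le> E (\<lambda>\<omega>. real n)"
    proof (rule E_mono)
      fix \<omega>
      have "card (zeroed n (\<lambda>_ _. True) \<omega>) \<le> card {..<n}" by (intro card_mono) (auto simp: zeroed_def)
      then show "real (card (zeroed n (\<lambda>_ _. True) \<omega>)) \<le> n" by simp
    qed
    then have Z: "E (\<lambda>\<omega>. card (zeroed n (\<lambda>_ _. True) \<omega>)) \<le> n" by (simp add: E_def)
    show ?thesis
    proof (rule mixture_scheme_cost[OF feas X(1) XD(1) _ _ XD(2) _ _ f01(1) _ Z])
      show "192 * k \<le> X" using X by (simp add: k_def)
      show "D = G / N" by (simp add: D_def)
      show "0 < q" using X n by (simp add: q_def)
      show "q \<le> X * D / (2 * n)" using X n D by (simp add: q_def field_simps)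
      show "f * D * n \<le> X / 64" using n D by (simp add: f_def)
      have "k\<^sup>2 \<le> X ^ 4 / (64 ^ 3 * real n ^ 3)"
        using X(3) n by (simp add: k_def field_simps)
      also have "\<dots> = X / 64 * (X / (64 * n)) * (X / (64 * n)) * (X / n)"
        by (simp add: power_def eval_nat_numeral)
      \<comment> \<open>Sparsity \<open>X * D \<le> n\<close> removes \<open>D\<close> at the price
        of one factor \<open>X / n\<close>; this is where the exponent 3/4 arises.\<close>
      also have "\<dots> \<le> X / 64 * (X / (64 * n)) * (X / (64 * n)) * (1 / D)"
        using XD n D X by (intro mult_left_mono) (auto simp: field_simps)
      also have "\<dots> = X / 64 * (q * f)" by (simp add: q_def f_def)
      finally show "k\<^sup>2 \<le> X / 64 * (q * f)" .
      show "q * n \<le> X / 64" using n by (simp add: q_def)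
      have "q * f * n = X / 64 * f" using n by (simp add: q_def)
      also have "\<dots> \<le> X / 64 * 1" using f01 X by (intro mult_left_mono) auto
      finally show "q * f * n \<le> X" using X by simp
    qed auto
  qed
qed

text \<open>Now \<open>Z = f * G / \<delta>\<close> is already at most \<open>X / 64\<close> by the
  choice of \<open>f\<close>, so \<open>q\<close> can be as large as \<open>p\<close>. The
  \<open>D\<close> in \<open>q\<close> cancels the one in \<open>f\<close>, and no factor is
  lost.\<close>

lemma scheme_edge_weights_ge:
  assumes W: "weighted_graph n W" and n: "n > 0" and \<delta>: "0 < \<delta>" "\<delta> \<le> 1" "edge_weights_ge n W \<delta>"
    and \<theta>: "\<And>v. v < n \<Longrightarrow> 0 \<le> \<theta> v" "\<And>v. v < n \<Longrightarrow> \<theta> v \<le> 1" and feas: "feasible n W \<theta>"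
    and X: "0 < X" "192 * (\<Sum>v<n. \<theta> v) \<le> X" "8192 * (\<Sum>v<n. \<theta> v)\<^sup>2 * (real n)\<^sup>2 \<le> X ^ 3 * \<delta>"
  shows "\<exists>S \<phi>. card S = 3 \<and> signaling_scheme n S \<phi> \<and> persuasive n W S \<phi> \<and> cost n \<phi> \<le> 4 * X"
proof -
  define D where "D = random_labels.G n W \<theta> / random_labels.N n \<theta>"
  have loc: "random_labels n W \<theta> 0" using W \<theta> by unfold_locales auto
  show ?thesis
  proof (cases "X > n \<or> X * D > n")
    case True
    then show ?thesis
      using random_labels.dense_scheme[OF loc] X n by (simp add: D_def random_labels.k_def[OF loc])
  next
    case False
    have N0: "random_labels.N n \<theta> > 0"
      using X False n by (simp add: random_labels.N_eq[OF loc] random_labels.k_def[OF loc])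
    then have D: "D \<ge> 1" using random_labels.N_le_G[OF loc] by (simp add: D_def)
    have XD: "X \<le> n" "X * D \<le> n" using False by auto
    define f where "f = X * \<delta> / (64 * n * D)"
    define q where "q = X * D / (2 * n)"
    have f01: "0 < f" "f \<le> 1"
    proof -
      show "0 < f" using X n D \<delta> by (simp add: f_def)
      have "X * \<delta> \<le> n * D" using XD D n \<delta> X by (intro mult_mono) auto
      then have "X * \<delta> / (n * D) \<le> 1" using n D by simp
      then have "1 / 64 * (X * \<delta> / (n * D)) \<le> 1 / 64 * 1" by (rule mult_left_mono) simp
      also have "1 / 64 * (X * \<delta> / (n * D)) = f" by (simp add: f_def)
      finally show "f \<le> 1" by simp
    qed
    interpret random_labels n W \<theta> f using W \<theta> f01 by unfold_locales auto
    have G: "G = D * N" using N0 by (simp add: D_def)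
    show ?thesis
    proof (rule mixture_scheme_cost[OF feas X(1) XD(1) _ _ XD(2) _ _ f01(1) _ expected_zeroed[OF \<delta>(1,3)]])
      show "192 * k \<le> X" using X by (simp add: k_def)
      show "D = G / N" by (simp add: D_def)
      show "0 < q" using X n D by (simp add: q_def)
      show "q \<le> X * D / (2 * n)" by (simp add: q_def)
      have "f * D * n = X / 64 * \<delta>" using n D by (simp add: f_def)
      also have "\<dots> \<le> X / 64 * 1" using X \<delta> by (intro mult_left_mono) auto
      finally show "f * D * n \<le> X / 64" by simp
      have qf: "q * f = X\<^sup>2 * \<delta> / (128 * (real n)\<^sup>2)"
        using D by (simp add: q_def f_def power2_eq_square)
      have "k\<^sup>2 \<le> X ^ 3 * \<delta> / (8192 * (real n)\<^sup>2)"
        using X(3) n by (simp add: k_def field_simps)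
      also have "\<dots> = X / 64 * (q * f)" unfolding qf by (simp add: power2_eq_square power3_eq_cube)
      finally show "k\<^sup>2 \<le> X / 64 * (q * f)" .
      have q1: "q \<le> 1 / 2" using XD n by (simp add: q_def field_simps)
      have N: "0 < N" "N \<le> n" using N0 k_nonneg by (auto simp: N_eq)
      have "q * (f * G / \<delta>) = q * (X / 64 * (N / n))" using \<delta> D by (simp add: G f_def)
      also have "\<dots> \<le> 1 * (X / 64 * 1)" using q1 N n X by (intro mult_mono mult_left_mono) auto
      finally show "q * (f * G / \<delta>) \<le> X / 64" by simp
      have "q * f * n = X * (X / (128 * n) * \<delta>)"
        unfolding qf using n by (simp add: power2_eq_square)
      also have "\<dots> \<le> X * (1 * 1)" using X XD \<delta> n by (intro mult_mono mult_left_mono) auto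
      finally show "q * f * n \<le> X" by simp
    qed auto
  qed
qed

section \<open>Choosing the target cost in terms of \<open>OPT_IR\<close>\<close>

lemma scheme_empty:
  "\<exists>S \<phi>. card S = 3 \<and> signaling_scheme 0 S \<phi> \<and> persuasive 0 W S \<phi> \<and> cost 0 \<phi> = 0"
  using scheme_of_random_sets[of 0 W "return_pmf ()" "\<lambda>_. {}" "\<lambda>_. {}" 1 1]
  by (simp add: weighted_graph_def)

lemma scheme_general_OPT:
  assumes W: "weighted_graph n W"
  shows "\<exists>S \<phi>. card S = 3 \<and> signaling_scheme n S \<phi> \<and> persuasive n W S \<phi> \<and>
           cost n \<phi> \<le> 1536 * real n powr (3/4) * sqrt (OPT_IR n W)"
proof (cases "n = 0")
  case True
  then show ?thesis using scheme_empty[of W] by simp (metis order_refl)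
next
  case False
  then have n: "n > 0" by simp
  obtain \<theta> where \<theta>: "\<And>v. v < n \<Longrightarrow> 0 \<le> \<theta> v" "\<And>v. v < n \<Longrightarrow> \<theta> v \<le> 1" "feasible n W \<theta>"
    and k: "1 \<le> (\<Sum>v<n. \<theta> v)" "(\<Sum>v<n. \<theta> v) \<le> 2 * OPT_IR n W"
    using near_optimal_IR[OF W n] by metis
  define k where "k = (\<Sum>v<n. \<theta> v)"
  have k1: "1 \<le> k" "k \<le> 2 * OPT_IR n W" "k \<le> n"
    using k sum_mono[of "{..<n}" \<theta> "\<lambda>_. 1"] \<theta> by (auto simp: k_def)
  \<comment> \<open>A multiple of the fourth root of \<open>k^2 * n^3\<close>; since
    \<open>k \<le> n\<close>, the factor 192 also yields \<open>192 * k \<le> X\<close>. The final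
    1536 is \<open>4 * 192\<close>, doubled to pass from \<open>k\<close> to
    \<open>OPT_IR\<close>.\<close>
  define X where "X = 192 * real n powr (3/4) * sqrt k"
  have "sqrt k \<le> sqrt n" using k1 by simp
  also have "\<dots> = real n powr (1/2)" by (simp add: powr_half_sqrt)
  also have "\<dots> \<le> real n powr (3/4)" using n by (intro powr_mono) auto
  finally have "sqrt k * sqrt k \<le> real n powr (3/4) * sqrt k" using k1 by (intro mult_right_mono) auto
  then have kX: "192 * k \<le> X" using k1 by (simp add: X_def)
  have n4: "(real n powr (3/4)) ^ 4 = real n ^ 3"
  proof -
    have "(real n powr (3/4)) ^ 4 = (real n powr (3/4)) powr 4" using n by simp
    also have "\<dots> = real n powr (3/4 * 4)" by (rule powr_powr)
    finally show ?thesis using n by simp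
  qed
  have k4: "sqrt k ^ 4 = k\<^sup>2"
    using k1 by (metis (no_types) mult_2 numeral_Bit0 power_add power2_eq_square real_sqrt_pow2 order_trans zero_le_one)
  have "X ^ 4 = 192 ^ 4 * (k\<^sup>2 * real n ^ 3)"
    by (simp only: X_def power_mult_distrib n4 k4 mult_ac)
  moreover have "64 ^ 3 * (k\<^sup>2 * real n ^ 3) \<le> 192 ^ 4 * (k\<^sup>2 * real n ^ 3)"
    by (intro mult_right_mono) auto
  ultimately have "64 ^ 3 * k\<^sup>2 * real n ^ 3 \<le> X ^ 4" by (simp only: mult.assoc)
  moreover have "0 < X" using n k1 by (simp add: X_def)
  ultimately obtain S \<phi> where *: "card S = 3" "signaling_scheme n S \<phi>" "persuasive n W S \<phi>" "cost n \<phi> \<le> 4 * X"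
    using scheme_general[OF W n \<theta>, of X] kX unfolding k_def by blast
  have "sqrt k \<le> sqrt (4 * OPT_IR n W)" using k1 by (intro real_sqrt_le_mono) auto
  also have "\<dots> = 2 * sqrt (OPT_IR n W)" by (simp add: real_sqrt_mult)
  finally have "768 * real n powr (3/4) * sqrt k \<le> 768 * real n powr (3/4) * (2 * sqrt (OPT_IR n W))"
    by (intro mult_left_mono) auto
  then have "cost n \<phi> \<le> 1536 * real n powr (3/4) * sqrt (OPT_IR n W)"
    using *(4) unfolding X_def by argo
  then show ?thesis using * by blast
qed

lemma scheme_edge_weights_ge_OPT:
  assumes W: "weighted_graph n W" and \<delta>: "0 < \<delta>" "\<delta> \<le> 1" "edge_weights_ge n W \<delta>"
  shows "\<exists>S \<phi>. card S = 3 \<and> signaling_scheme n S \<phi> \<and> persuasive n W S \<phi> \<and>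
           cost n \<phi> \<le> 1536 * (real n * OPT_IR n W) powr (2/3) * \<delta> powr (-1/3)"
proof (cases "n = 0")
  case True
  then show ?thesis using scheme_empty[of W] by simp (metis order_refl)
next
  case False
  then have n: "n > 0" by simp
  obtain \<theta> where \<theta>: "\<And>v. v < n \<Longrightarrow> 0 \<le> \<theta> v" "\<And>v. v < n \<Longrightarrow> \<theta> v \<le> 1" "feasible n W \<theta>"
    and k: "1 \<le> (\<Sum>v<n. \<theta> v)" "(\<Sum>v<n. \<theta> v) \<le> 2 * OPT_IR n W"
    using near_optimal_IR[OF W n] by metis
  define k where "k = (\<Sum>v<n. \<theta> v)"
  have k1: "1 \<le> k" "k \<le> 2 * OPT_IR n W" "k \<le> n"
    using k sum_mono[of "{..<n}" \<theta> "\<lambda>_. 1"] \<theta> by (auto simp: k_def)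
  define r where "r = (real n * k) powr (2/3)"
  define d where "d = \<delta> powr (-1/3)"
  \<comment> \<open>A multiple of the cube root of \<open>k^2 * n^2 / \<delta>\<close>, with 192
    again securing \<open>192 * k \<le> X\<close>.\<close>
  define X where "X = 192 * r * d"
  have nk: "real n * k > 0" using n k1 by simp
  have r3: "r ^ 3 = (real n * k)\<^sup>2"
  proof -
    have "r ^ 3 = r powr 3" using nk by (simp add: r_def)
    also have "\<dots> = (real n * k) powr (2/3 * 3)" unfolding r_def by (rule powr_powr)
    finally show ?thesis using nk by simp
  qed
  have d3: "d ^ 3 * \<delta> = 1"
  proof -
    have "d ^ 3 = d powr 3" using \<delta> by (simp add: d_def)
    also have "\<dots> = \<delta> powr (-1/3 * 3)" unfolding d_def by (rule powr_powr)
    finally show ?thesis using \<delta> by (simp add: powr_minus)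
  qed
  have d1: "1 \<le> d"
  proof -
    have "\<delta> powr 0 \<le> \<delta> powr (-1/3)" using \<delta> by (intro powr_mono') auto
    then show ?thesis using \<delta> by (simp add: d_def)
  qed
  have kr: "k \<le> r"
  proof (rule power_le_imp_le_base[of _ 2])
    have "k ^ 3 \<le> r ^ 3"
    proof -
      \<comment> \<open>Here \<open>1 \<le> k\<close> is used, and \<open>k \<le> n\<close> below;
        cubes avoid comparing fractional powers.\<close>
      have "k ^ 3 \<le> k ^ 4" using k1 by (intro power_increasing) auto
      also have "\<dots> = (k * k)\<^sup>2" by (simp add: power2_eq_square eval_nat_numeral)
      also have "\<dots> \<le> (real n * k)\<^sup>2" using k1 by (intro power_mono mult_right_mono) auto
      finally show ?thesis by (simp add: r3)
    qed
    then show "k ^ Suc 2 \<le> r ^ Suc 2" by (simp add: eval_nat_numeral)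
  qed (simp add: r_def)
  have "k * 1 \<le> r * d" using kr d1 k1 by (intro mult_mono) auto
  then have kX: "192 * k \<le> X" by (simp add: X_def)
  have "X ^ 3 * \<delta> = 192 ^ 3 * (real n * k)\<^sup>2 * (d ^ 3 * \<delta>)"
    by (simp only: X_def power_mult_distrib[of _ _ 3] r3 mult_ac)
  also have "\<dots> = 192 ^ 3 * (k\<^sup>2 * (real n)\<^sup>2)" by (simp add: d3 power_mult_distrib)
  also have "\<dots> \<ge> 8192 * (k\<^sup>2 * (real n)\<^sup>2)" by (intro mult_right_mono) auto
  finally have "8192 * k\<^sup>2 * (real n)\<^sup>2 \<le> X ^ 3 * \<delta>" by (simp only: mult.assoc)
  moreover have "0 < X" using kX k1 by simp
  ultimately obtain S \<phi> where *: "card S = 3" "signaling_scheme n S \<phi>" "persuasive n W S \<phi>" "cost n \<phi> \<le> 4 * X"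
    using scheme_edge_weights_ge[OF W n \<delta> \<theta>, of X] kX unfolding k_def by blast
  have O: "OPT_IR n W \<ge> 0" using k1 by simp
  have "r \<le> (2 * (real n * OPT_IR n W)) powr (2/3)"
    unfolding r_def using k1 mult_left_mono[of k "2 * OPT_IR n W" "real n"] nk
    by (intro powr_mono2) (auto simp: mult_ac)
  also have "\<dots> = 2 powr (2/3) * (real n * OPT_IR n W) powr (2/3)"
    using O by (subst powr_mult) auto
  also have "\<dots> \<le> 2 powr 1 * (real n * OPT_IR n W) powr (2/3)"
    by (intro mult_right_mono powr_mono) auto
  finally have "768 * r * d \<le> 768 * (2 * (real n * OPT_IR n W) powr (2/3)) * d"
    using d1 by (intro mult_right_mono mult_left_mono) auto
  then have "cost n \<phi> \<le> 1536 * (real n * OPT_IR n W) powr (2/3) * d"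
    using *(4) unfolding X_def by argo
  then show ?thesis using * unfolding d_def by blast
qed

theorem theorem1p2:
  shows "(\<exists>C>0.
     (\<forall>n W. weighted_graph n W \<longrightarrow>
        (\<exists>S \<phi>. card S = 3 \<and> signaling_scheme n S \<phi> \<and> persuasive n W S \<phi> \<and>
           cost n \<phi> \<le> C * real n powr (3/4) * sqrt (OPT_IR n W))) \<and>
     (\<forall>\<delta> n W. 0 < \<delta> \<and> \<delta> \<le> 1 \<and> weighted_graph n W \<and> edge_weights_ge n W \<delta> \<longrightarrow>
        (\<exists>S \<phi>. card S = 3 \<and> signaling_scheme n S \<phi> \<and> persuasive n W S \<phi> \<and>
           cost n \<phi> \<le> C * (real n * OPT_IR n W) powr (2/3) * \<delta> powr (-1/3)))) \<and>
   (\<exists>c>0. \<exists>M. \<forall>N. \<exists>n\<ge>N. \<exists>W. weighted_graph n W \<and> edge_weights_eq n W (1/2) \<and>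
          OPT_IR n W \<le> M \<and>
          (\<forall>S \<phi>. signaling_scheme n S \<phi> \<and> persuasive n W S \<phi> \<longrightarrow> cost n \<phi> \<ge> c * real n powr (2/3)))"
proof (intro conjI)
  show "\<exists>C>0.
     (\<forall>n W. weighted_graph n W \<longrightarrow>
        (\<exists>S \<phi>. card S = 3 \<and> signaling_scheme n S \<phi> \<and> persuasive n W S \<phi> \<and>
           cost n \<phi> \<le> C * real n powr (3/4) * sqrt (OPT_IR n W))) \<and>
     (\<forall>\<delta> n W. 0 < \<delta> \<and> \<delta> \<le> 1 \<and> weighted_graph n W \<and> edge_weights_ge n W \<delta> \<longrightarrow>
        (\<exists>S \<phi>. card S = 3 \<and> signaling_scheme n S \<phi> \<and> persuasive n W S \<phi> \<and>
           cost n \<phi> \<le> C * (real n * OPT_IR n W) powr (2/3) * \<delta> powr (-1/3)))"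
    using scheme_general_OPT scheme_edge_weights_ge_OPT by (intro exI[of _ 1536]) auto
  show "\<exists>c>0. \<exists>M. \<forall>N. \<exists>n\<ge>N. \<exists>W. weighted_graph n W \<and> edge_weights_eq n W (1/2) \<and>
          OPT_IR n W \<le> M \<and>
          (\<forall>S \<phi>. signaling_scheme n S \<phi> \<and> persuasive n W S \<phi> \<longrightarrow> cost n \<phi> \<ge> c * real n powr (2/3))"
  proof (rule exI[of _ "1 / 1024"], rule conjI, simp, rule exI[of _ 2], rule allI)
    fix N :: nat
    define L where "L = max 200 N"
    have "N \<le> L ^ 1" by (simp add: L_def)
    also have "\<dots> \<le> L ^ 3" by (rule power_increasing) (auto simp: L_def)
    finally have "N \<le> L ^ 3 + 2" by simp
    moreover have "L \<ge> 200" by (simp add: L_def)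
    ultimately show "\<exists>n\<ge>N. \<exists>W. weighted_graph n W \<and> edge_weights_eq n W (1/2) \<and> OPT_IR n W \<le> 2 \<and>
        (\<forall>S \<phi>. signaling_scheme n S \<phi> \<and> persuasive n W S \<phi> \<longrightarrow> cost n \<phi> \<ge> 1 / 1024 * real n powr (2/3))"
      using weighted_graph_clique_graph edge_weights_eq_clique_graph OPT_IR_clique_graph clique_graph_cost
      by (intro exI[of _ "L ^ 3 + 2"] conjI exI[of _ "clique_graph L"]) blast+
  qed
qed

end
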